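(* Let $\Gamma$ be a metrized graph with an optimal vertex set $V(\Gamma)$ of $v$ vertices and edge set $E(\Gamma)$, let $\mathrm{L}=(l_{pq})$ be its discrete Laplacian matrix and $\mathrm{L}^+=(l^+_{pq})$ its pseudo inverse, and let $p_i,q_i$ be the endpoints of $e_i\in E(\Gamma)$. Then $$\tau(\Gamma)=-\frac1{12}\sum_{e_i\in E(\Gamma)} l_{p_iq_i}\Big(\frac1{l_{p_iq_i}}+l^+_{p_ip_i}-2l^+_{p_iq_i}+l^+_{q_iq_i}\Big)^2+\frac14\sum_{q,s\in V(\Gamma)} l_{qs}l^+_{qq}l^+_{ss}+\frac1v\mathrm{tr}(\mathrm{L}^+),$$ and $$\tau(\Gamma)=-\frac1{12}\sum_{e_i\in E(\Gamma)} l_{p_iq_i}\Big(\frac1{l_{p_iq_i}}+l^+_{p_ip_i}-2l^+_{p_iq_i}+l^+_{q_iq_i}\Big)^2-\frac14\sum_{e_i\in E(\Gamma)} l_{p_iq_i}\big(l^+_{p_ip_i}-l^+_{q_iq_i}\big)^2+\frac1v\mathrm{tr}(\mathrm{L}^+).$$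
   Context: A metrized graph $\Gamma$ is a finite connected graph (multiple edges and self-loops allowed) whose edges are identified with closed segments of positive lengths; its vertex set is finite, nonempty, and contains every point of valence $\neq2$ (valence = number of directions emanating from the point). A vertex set $V(\Gamma)$ is optimal if with respect to it there are no self-loops and no two edges joining the same pair of vertices (this can always be achieved by adding valence-2 points as vertices). Fix an ordering of $V(\Gamma)$. The discrete Laplacian $\mathrm{L}=(l_{pq})_{v\times v}$: for $p\neq q$, $l_{pq}=-1/L_k$ if $p,q$ are joined by an edge of length $L_k$ and $0$ otherwise; $l_{pp}=-\sum_{s\neq p}l_{ps}$. $\mathrm{L}^+$ is its Moore–Penrose pseudo inverse. Viewing $\Gamma$ as a resistive electric circuit with each edge of resistance equal to its length, the voltage function $j_z(x,y)$ is the voltage at $x$ when unit current enters at $y$ and exits at $z$, with reference voltage $0$ at $z$. There is a unique real signed Borel measure $\mu_{can}$ on $\Gamma$ of total mass $1$ (the canonical measure) such that $\int_\Gamma j_\zeta(x,x)\,d\mu_{can}(\zeta)$ is constant in $x\in\Gamma$; the tau constant $\tau(\Gamma)$ is one half of this constant. *)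

theory Defs
  imports "HOL-Analysis.Analysis" "Graph_Theory.Digraph_Component"
begin

section \<open>Metrized graphs\<close>

text \<open>
  A metrized graph with a vertex set is a finite connected multigraph \<open>G\<close> (loops and parallel
  edges allowed) with positive edge lengths \<open>len\<close>. The direction of an arc carries no meaning:
  it only fixes which end of the segment \<open>[0, len e]\<close> is glued to which vertex, and
  connectedness is that of the underlying undirected graph, which is what
  \<^const>\<open>Digraph_Component.connected\<close> says (it also forces the vertex set to be nonempty).
  Only points in the interior of an edge are not vertices, so points of valence
  different from 2 are automatically vertices.
\<close>

definition metrized_graph :: "('v, 'e) pre_digraph \<Rightarrow> ('e \<Rightarrow> real) \<Rightarrow> bool" where
  "metrized_graph G len \<longleftrightarrow>
     fin_digraph G \<and> Digraph_Component.connected G \<and> (\<forall>e\<in>arcs G. len e > 0)"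

definition joins :: "('v, 'e) pre_digraph \<Rightarrow> 'e \<Rightarrow> 'v \<Rightarrow> 'v \<Rightarrow> bool" where
  "joins G e p q \<longleftrightarrow> e \<in> arcs G \<and> {tail G e, head G e} = {p, q}"

definition optimal_vertex_set :: "('v, 'e) pre_digraph \<Rightarrow> bool" where
  "optimal_vertex_set G \<longleftrightarrow>
     (\<forall>e\<in>arcs G. tail G e \<noteq> head G e) \<and>
     (\<forall>e e' p q. joins G e p q \<and> joins G e' p q \<longrightarrow> e = e')"

subsection \<open>The space of points\<close>

text \<open>\<open>Inner e t\<close> is the point of the open edge \<open>e\<close> at distance \<open>t\<close> from its tail along \<open>e\<close>.\<close>

datatype ('v, 'e) mg_point = Vertex 'v | Inner 'e real

definition mg_points :: "('v, 'e) pre_digraph \<Rightarrow> ('e \<Rightarrow> real) \<Rightarrow> ('v, 'e) mg_point set" where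
  "mg_points G len = Vertex ` verts G \<union> {Inner e t |e t. e \<in> arcs G \<and> 0 < t \<and> t < len e}"

text \<open>The parametrization \<open>[0, len e] \<rightarrow> \<Gamma>\<close> of the edge \<open>e\<close> (clamped outside this interval).\<close>

definition edge_point ::
    "('v, 'e) pre_digraph \<Rightarrow> ('e \<Rightarrow> real) \<Rightarrow> 'e \<Rightarrow> real \<Rightarrow> ('v, 'e) mg_point" where
  "edge_point G len e t =
     (if t \<le> 0 then Vertex (tail G e)
      else if t \<ge> len e then Vertex (head G e)
      else Inner e t)"

text \<open>The topology obtained by gluing the closed segments \<open>[0, len e]\<close> at the vertices.\<close>

definition mg_topology ::
    "('v, 'e) pre_digraph \<Rightarrow> ('e \<Rightarrow> real) \<Rightarrow> ('v, 'e) mg_point topology" where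
  "mg_topology G len = topology (\<lambda>U. U \<subseteq> mg_points G len \<and>
     (\<forall>e\<in>arcs G. openin (top_of_set {0..len e}) {t\<in>{0..len e}. edge_point G len e t \<in> U}))"

lemma openin_mg_topology:
  "openin (mg_topology G len) U \<longleftrightarrow> U \<subseteq> mg_points G len \<and>
     (\<forall>e\<in>arcs G. openin (top_of_set {0..len e}) {t\<in>{0..len e}. edge_point G len e t \<in> U})"
proof -
  let ?P = "\<lambda>U. U \<subseteq> mg_points G len \<and>
     (\<forall>e\<in>arcs G. openin (top_of_set {0..len e}) {t\<in>{0..len e}. edge_point G len e t \<in> U})"
  have "istopology ?P"
    unfolding istopology_def
  proof (intro conjI allI impI)
    fix S T assume "?P S" "?P T"
    moreover have "{t\<in>{0..len e}. edge_point G len e t \<in> S \<inter> T} =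
        {t\<in>{0..len e}. edge_point G len e t \<in> S} \<inter> {t\<in>{0..len e}. edge_point G len e t \<in> T}" for e
      by auto
    ultimately show "S \<inter> T \<subseteq> mg_points G len"
      and "\<forall>e\<in>arcs G. openin (top_of_set {0..len e})
              {t\<in>{0..len e}. edge_point G len e t \<in> S \<inter> T}"
      by (auto intro!: openin_Int)
  next
    fix \<U> assume *: "\<forall>U\<in>\<U>. ?P U"
    then show "\<Union>\<U> \<subseteq> mg_points G len" by auto
    have "{t\<in>{0..len e}. edge_point G len e t \<in> \<Union>\<U>} =
        (\<Union>U\<in>\<U>. {t\<in>{0..len e}. edge_point G len e t \<in> U})" for e
      by auto
    with * show "\<forall>e\<in>arcs G. openin (top_of_set {0..len e})
        {t\<in>{0..len e}. edge_point G len e t \<in> \<Union>\<U>}"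
      by (auto intro!: openin_Union)
  qed
  then show ?thesis
    by (simp add: mg_topology_def topology_inverse')
qed

definition mg_borel :: "('v, 'e) pre_digraph \<Rightarrow> ('e \<Rightarrow> real) \<Rightarrow> ('v, 'e) mg_point measure" where
  "mg_borel G len = sigma (mg_points G len) {U. openin (mg_topology G len) U}"

section \<open>The voltage function\<close>

text \<open>
  \<open>(e, t, s)\<close> with \<open>s = \<plusminus>1\<close> is the direction emanating from the point \<open>edge_point G len e t\<close>
  along \<open>e\<close> towards increasing (\<open>s = 1\<close>) or decreasing (\<open>s = -1\<close>) parameter. The number of
  directions at a point is its valence; a loop contributes two directions at its vertex.
\<close>

definition directions ::
    "('v, 'e) pre_digraph \<Rightarrow> ('e \<Rightarrow> real) \<Rightarrow> ('v, 'e) mg_point \<Rightarrow> ('e \<times> real \<times> real) set" where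
  "directions G len p =
     {(e, t, s). e \<in> arcs G \<and> t \<in> {0..len e} \<and> edge_point G len e t = p \<and>
                 (s = 1 \<and> t < len e \<or> s = -1 \<and> 0 < t)}"

text \<open>Along the given direction, \<open>f\<close> is affine with outgoing slope \<open>m\<close> near the base point.\<close>

fun has_slope ::
    "('v, 'e) pre_digraph \<Rightarrow> ('e \<Rightarrow> real) \<Rightarrow> (('v, 'e) mg_point \<Rightarrow> real) \<Rightarrow>
     'e \<times> real \<times> real \<Rightarrow> real \<Rightarrow> bool" where
  "has_slope G len f (e, t, s) m \<longleftrightarrow>
     (\<forall>\<^sub>F h in at_right 0. f (edge_point G len e (t + s * h)) = f (edge_point G len e t) + m * h)"

text \<open>
  \<open>f\<close> is the voltage when unit current enters at \<open>y\<close> and exits at \<open>z\<close>, with reference voltage 0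
  at \<open>z\<close>. Resistance is arc length, so by Ohm's law the voltage is piecewise affine and the
  current leaving a point in a given direction is minus the outgoing slope. Kirchhoff's current
  law says that the total current leaving \<open>p\<close> through the edges equals the current injected
  at \<open>p\<close> from outside, which is \<open>1\<close> at \<open>y\<close>, \<open>-1\<close> at \<open>z\<close> and \<open>0\<close> elsewhere (and
  \<open>0\<close> everywhere when \<open>y = z\<close>).
\<close>

definition is_voltage ::
    "('v, 'e) pre_digraph \<Rightarrow> ('e \<Rightarrow> real) \<Rightarrow> ('v, 'e) mg_point \<Rightarrow> ('v, 'e) mg_point \<Rightarrow>
     (('v, 'e) mg_point \<Rightarrow> real) \<Rightarrow> bool" where
  "is_voltage G len z y f \<longleftrightarrow>
     f \<in> extensional (mg_points G len) \<and> f z = 0 \<and>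
     (\<exists>m. \<forall>p\<in>mg_points G len.
        (\<forall>d\<in>directions G len p. has_slope G len f d (m d)) \<and>
        (\<Sum>d\<in>directions G len p. - m d) = of_bool (p = y) - of_bool (p = z))"

text \<open>\<open>voltage G len z x y\<close> is the value usually written \<open>j\<^sub>z(x, y)\<close>.\<close>

definition voltage ::
    "('v, 'e) pre_digraph \<Rightarrow> ('e \<Rightarrow> real) \<Rightarrow> ('v, 'e) mg_point \<Rightarrow> ('v, 'e) mg_point \<Rightarrow>
     ('v, 'e) mg_point \<Rightarrow> real" where
  "voltage G len z x y = (THE f. is_voltage G len z y f) x"

section \<open>Real signed measures\<close>

definition signed_measure :: "'a measure \<Rightarrow> ('a set \<Rightarrow> real) \<Rightarrow> bool" where
  "signed_measure M \<nu> \<longleftrightarrow>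
     (\<forall>A. range A \<subseteq> sets M \<and> disjoint_family A \<longrightarrow> (\<lambda>i. \<nu> (A i)) sums \<nu> (\<Union>i::nat. A i))"

text \<open>
  The positive part \<open>A \<mapsto> sup {\<nu>(B) : B \<subseteq> A}\<close> of \<open>\<nu>\<close>; \<open>ennreal\<close> truncates negative values
  to 0, which is harmless since \<open>\<nu>({}) = 0\<close> occurs in the supremum. The negative part of \<open>\<nu>\<close> is
  the positive part of \<open>-\<nu>\<close>, and integration against \<open>\<nu>\<close> is by the Jordan decomposition.
\<close>

definition positive_part :: "'a measure \<Rightarrow> ('a set \<Rightarrow> real) \<Rightarrow> 'a measure" where
  "positive_part M \<nu> =
     measure_of (space M) (sets M) (\<lambda>A. SUP B\<in>{B \<in> sets M. B \<subseteq> A}. ennreal (\<nu> B))"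

definition signed_integral :: "'a measure \<Rightarrow> ('a set \<Rightarrow> real) \<Rightarrow> ('a \<Rightarrow> real) \<Rightarrow> real" where
  "signed_integral M \<nu> f =
     (\<integral>x. f x \<partial>positive_part M \<nu>) - (\<integral>x. f x \<partial>positive_part M (\<lambda>A. - \<nu> A))"

section \<open>The canonical measure and the tau constant\<close>

definition is_canonical_measure ::
    "('v, 'e) pre_digraph \<Rightarrow> ('e \<Rightarrow> real) \<Rightarrow> (('v, 'e) mg_point set \<Rightarrow> real) \<Rightarrow> bool" where
  "is_canonical_measure G len \<nu> \<longleftrightarrow>
     signed_measure (mg_borel G len) \<nu> \<and> \<nu> (mg_points G len) = 1 \<and>
     (\<exists>c. \<forall>x\<in>mg_points G len. signed_integral (mg_borel G len) \<nu> (\<lambda>\<zeta>. voltage G len \<zeta> x x) = c)"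

text \<open>The canonical measure being unique, \<open>t\<close> below is half of the constant belonging to it.\<close>

definition tau :: "('v, 'e) pre_digraph \<Rightarrow> ('e \<Rightarrow> real) \<Rightarrow> real" where
  "tau G len = (THE t. \<exists>\<nu>. is_canonical_measure G len \<nu> \<and>
     (\<forall>x\<in>mg_points G len.
        t = signed_integral (mg_borel G len) \<nu> (\<lambda>\<zeta>. voltage G len \<zeta> x x) / 2))"

section \<open>The discrete Laplacian and the Moore--Penrose pseudo inverse\<close>

text \<open>
  The matrices are indexed by the vertices themselves, so the type of vertices is finite and the
  definition is meant for graphs whose vertex set is the whole type. It is also meant for optimal
  vertex sets only, where the edge joining two given vertices is unique.
\<close>

definition laplacian_entry ::
    "('v, 'e) pre_digraph \<Rightarrow> ('e \<Rightarrow> real) \<Rightarrow> 'v \<Rightarrow> 'v \<Rightarrow> real" where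
  "laplacian_entry G len p q =
     (if \<exists>e. joins G e p q then - 1 / len (THE e. joins G e p q) else 0)"

definition discrete_laplacian ::
    "('v::finite, 'e) pre_digraph \<Rightarrow> ('e \<Rightarrow> real) \<Rightarrow> real ^ 'v ^ 'v" where
  "discrete_laplacian G len =
     (\<chi> p q. if p \<noteq> q then laplacian_entry G len p q
             else - (\<Sum>s\<in>UNIV - {p}. laplacian_entry G len p s))"

definition is_pseudo_inverse :: "real ^ 'n::finite ^ 'm::finite \<Rightarrow> real ^ 'm ^ 'n \<Rightarrow> bool" where
  "is_pseudo_inverse A X \<longleftrightarrow>
     A ** X ** A = A \<and> X ** A ** X = X \<and>
     transpose (A ** X) = A ** X \<and> transpose (X ** A) = X ** A"

definition pseudo_inverse :: "real ^ 'n::finite ^ 'm::finite \<Rightarrow> real ^ 'm ^ 'n" where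
  "pseudo_inverse A = (THE X. is_pseudo_inverse A X)"

end

theory Submission
  imports Defs
begin

text \<open>
  Let \<open>K\<close> be the pseudo inverse of the Laplacian \<open>L\<close>, let \<open>hat x\<close> be the barycentric
  coordinates of the point \<open>x\<close> with respect to the ends of its edge, and let \<open>bridge e\<close> be the
  Green function of the segment \<open>e\<close> with both ends grounded. Since \<open>L K\<close> is the identity minus the
  projection onto the constants,
  \<open>g x y = (hat x)\<^sup>T K (hat y) + (\<Sum>e. bridge e x y)\<close> is a Green function of the metrized
  graph, and \<open>j\<^sub>z(x, x) = g x x - 2 * g x z + g z z\<close>.

  On an edge of length \<open>l\<close> with ends \<open>p\<close> and \<open>q\<close>, the function \<open>x \<mapsto> g x x\<close> is quadratic, and
  if the edge gets constant density \<open>(l - r(p, q)) / l\<^sup>2\<close>, where \<open>r\<close> is the effective resistance,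
  then the integral of \<open>2 * g x\<close> is quadratic in \<open>x\<close> with the same quadratic term.
  Point masses at the vertices can then be chosen such that \<open>\<integral> hat \<zeta> d\<mu>(\<zeta>)\<close> is
  \<open>1/v + (L k)/2\<close>, where \<open>k\<close> is the diagonal of \<open>K\<close>; this makes the affine parts cancel and gives the
  value of the constant. The constant does not depend on the choice of the canonical measure: by
  Fubini and the symmetry of \<open>j\<^sub>z(x, x)\<close> any two measures of total mass \<open>1\<close> with this property have
  the same constant.
\<close>

section \<open>Real signed measures\<close>

lemma signed_measure_empty:
  assumes "signed_measure M \<nu>"
  shows "\<nu> {} = 0"
proof -
  have "(\<lambda>i::nat. \<nu> {}) sums \<nu> (\<Union>i::nat. {})"
    using assms[unfolded signed_measure_def, rule_format, of "\<lambda>_. {}"]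
    by (simp add: disjoint_family_on_def)
  then have "(\<lambda>i::nat. \<nu> {}) \<longlonglongrightarrow> 0"
    by (intro summable_LIMSEQ_zero sums_summable)
  then show ?thesis
    by (simp add: LIMSEQ_const_iff)
qed

lemma signed_measure_Un:
  assumes "signed_measure M \<nu>" "A \<in> sets M" "B \<in> sets M" "A \<inter> B = {}"
  shows "\<nu> (A \<union> B) = \<nu> A + \<nu> B"
proof -
  have "(\<lambda>i. \<nu> (binaryset A B i)) sums \<nu> (\<Union>i. binaryset A B i)"
    using assms(2-4)
    by (intro assms(1)[unfolded signed_measure_def, rule_format])
       (auto simp: range_binaryset_eq disjoint_family_on_def binaryset_def)
  moreover have "(\<lambda>i. \<nu> (binaryset A B i)) sums (\<nu> A + \<nu> B)"
    by (rule binaryset_sums) (rule signed_measure_empty[OF assms(1)])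
  ultimately show ?thesis
    by (metis UN_binaryset_eq sums_unique2)
qed

lemma signed_measure_Diff:
  assumes "signed_measure M \<nu>" "A \<in> sets M" "B \<in> sets M" "B \<subseteq> A"
  shows "\<nu> (A - B) = \<nu> A - \<nu> B"
proof -
  have "(A - B) \<inter> B = {}" "(A - B) \<union> B = A" using assms(4) by auto
  then show ?thesis
    using signed_measure_Un[OF assms(1), of "A - B" B] assms(2,3) by simp
qed

lemma signed_measure_uminus:
  "signed_measure M \<nu> \<Longrightarrow> signed_measure M (\<lambda>A. - \<nu> A)"
  unfolding signed_measure_def using sums_minus by metis

text \<open>If the values were unbounded, repeated splitting would give a decreasing sequence of
  sets on which \<open>\<nu>\<close> stays unbounded, each step discarding a piece of value larger
  than 1 in absolute value. The discarded pieces are disjoint, so countable additivity would force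
  their values to tend to 0.\<close>

lemma signed_measure_bounded:
  assumes \<nu>: "signed_measure M \<nu>"
  shows "\<exists>C. \<forall>B\<in>sets M. \<bar>\<nu> B\<bar> \<le> C"
proof (rule ccontr)
  define bad where "bad A \<longleftrightarrow> A \<in> sets M \<and> (\<forall>C. \<exists>B\<in>sets M. B \<subseteq> A \<and> \<bar>\<nu> B\<bar> > C)" for A
  assume "\<not> ?thesis"
  then have bad_space: "bad (space M)"
    unfolding bad_def by (meson linorder_not_le sets.sets_into_space sets.top)
  have bad_Un: "bad A \<or> bad B" if AB: "A \<in> sets M" "B \<in> sets M" "A \<inter> B = {}" "bad (A \<union> B)" for A B
  proof (rule ccontr)
    assume "\<not> (bad A \<or> bad B)"
    then obtain C D where C: "\<And>X. X \<in> sets M \<Longrightarrow> X \<subseteq> A \<Longrightarrow> \<bar>\<nu> X\<bar> \<le> C"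
      and D: "\<And>X. X \<in> sets M \<Longrightarrow> X \<subseteq> B \<Longrightarrow> \<bar>\<nu> X\<bar> \<le> D"
      unfolding bad_def using AB by (meson linorder_not_le)
    obtain X where X: "X \<in> sets M" "X \<subseteq> A \<union> B" "\<bar>\<nu> X\<bar> > C + D"
      using AB(4) unfolding bad_def by blast
    have "\<nu> ((X \<inter> A) \<union> (X \<inter> B)) = \<nu> (X \<inter> A) + \<nu> (X \<inter> B)"
      using X AB by (intro signed_measure_Un[OF \<nu>]) auto
    moreover have "(X \<inter> A) \<union> (X \<inter> B) = X" using X by auto
    moreover have "\<bar>\<nu> (X \<inter> A)\<bar> \<le> C" "\<bar>\<nu> (X \<inter> B)\<bar> \<le> D" using X AB C D by auto
    ultimately show False using X by auto
  qed
  have split: "\<exists>B. bad B \<and> B \<subseteq> A \<and> \<bar>\<nu> (A - B)\<bar> > 1" if A: "bad A" for A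
  proof -
    \<comment> \<open>The margin over the value of \<open>A\<close> makes both \<open>B\<close> and
      \<open>A - B\<close> larger than 1 in absolute value, so either may be discarded and a
      \<open>bad\<close> one is kept.\<close>
    obtain B where B: "B \<in> sets M" "B \<subseteq> A" "\<bar>\<nu> B\<bar> > \<bar>\<nu> A\<bar> + 1"
      using A unfolding bad_def by blast
    have AM: "A \<in> sets M" using A unfolding bad_def by blast
    have "\<nu> (A - B) = \<nu> A - \<nu> B" using signed_measure_Diff[OF \<nu> AM B(1,2)] .
    then have big: "\<bar>\<nu> (A - B)\<bar> > 1" "\<bar>\<nu> B\<bar> > 1" using B by linarith+
    have "bad B \<or> bad (A - B)"
      using bad_Un[of B "A - B"] A B AM by (auto simp: Un_absorb1)
    then show ?thesis
    proof
      assume "bad B"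
      then show ?thesis using B big by blast
    next
      assume "bad (A - B)"
      moreover have "A - (A - B) = B" using B by auto
      ultimately show ?thesis using big by (intro exI[of _ "A - B"]) auto
    qed
  qed
  have "\<exists>S. \<forall>n. bad (S n) \<and> S (Suc n) \<subseteq> S n \<and> \<bar>\<nu> (S n - S (Suc n))\<bar> > 1"
    by (rule dependent_nat_choice) (use bad_space split in auto)
  then obtain S where S: "\<And>n. bad (S n)" "\<And>n. S (Suc n) \<subseteq> S n" "\<And>n. \<bar>\<nu> (S n - S (Suc n))\<bar> > 1"
    by metis
  have "decseq S" using S(2) by (rule decseq_SucI)
  then have "S n \<subseteq> S (Suc m)" if "m < n" for m n
    using that by (simp add: decseqD Suc_leI)
  then have "disjoint_family (\<lambda>n. S n - S (Suc n))"
    unfolding disjoint_family_on_def by (metis (no_types, lifting) Diff_iff disjoint_iff linorder_neqE_nat subsetD)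
  moreover have "range (\<lambda>n. S n - S (Suc n)) \<subseteq> sets M"
    using S(1) unfolding bad_def by auto
  ultimately have "(\<lambda>n. \<nu> (S n - S (Suc n))) \<longlonglongrightarrow> 0"
    by (intro summable_LIMSEQ_zero sums_summable[OF \<nu>[unfolded signed_measure_def, rule_format]] conjI)
  then have "\<forall>\<^sub>F n in sequentially. \<bar>\<nu> (S n - S (Suc n))\<bar> < 1"
    using tendstoD[of "\<lambda>n. \<nu> (S n - S (Suc n))" 0 sequentially 1] by simp
  then obtain n where "\<bar>\<nu> (S n - S (Suc n))\<bar> < 1"
    by (auto simp: eventually_sequentially)
  then show False using S(3)[of n] by simp
qed

section \<open>Jordan decomposition of a signed measure\<close>

lemma space_positive_part [simp]: "space (positive_part M \<nu>) = space M"
  by (simp add: positive_part_def space_measure_of_conv)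

lemma sets_positive_part [measurable_cong, simp]: "sets (positive_part M \<nu>) = sets M"
  by (simp add: positive_part_def)

text \<open>\<open>measure_of\<close> keeps a set function only if it is a measure, so the supremum
  has to be shown countably additive. Superadditivity on disjoint sets comes from uniting subsets of
  the two; the converse inequality cuts a subset of the union along the \<open>A i\<close>.\<close>

lemma emeasure_positive_part:
  assumes \<nu>: "signed_measure M \<nu>" and A: "A \<in> sets M"
  shows "emeasure (positive_part M \<nu>) A = (SUP B\<in>{B \<in> sets M. B \<subseteq> A}. ennreal (\<nu> B))"
proof -
  define P where "P A = (SUP B\<in>{B \<in> sets M. B \<subseteq> A}. ennreal (\<nu> B))" for A
  have upper: "ennreal (\<nu> B) \<le> P A" if "B \<in> sets M" "B \<subseteq> A" for A B
    unfolding P_def using that by (intro SUP_upper) auto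
  have mono: "P A \<le> P B" if "A \<subseteq> B" for A B
    unfolding P_def using that by (intro SUP_subset_mono) auto
  have super: "P A + P B \<le> P (A \<union> B)" if "A \<inter> B = {}" for A B
  proof -
    \<comment> \<open>As \<open>ennreal\<close> truncates at 0, it is additive only for nonnegative
      values; a subset of negative value is replaced by \<open>{}\<close>.\<close>
    have nonneg: "\<exists>B'. B' \<in> sets M \<and> B' \<subseteq> A \<and> \<nu> B' \<ge> 0 \<and> ennreal (\<nu> B) \<le> ennreal (\<nu> B')"
      if "B \<in> sets M" "B \<subseteq> A" for A B
      by (cases "\<nu> B \<ge> 0")
         (use that signed_measure_empty[OF \<nu>] in \<open>auto intro: exI[of _ B] exI[of _ "{}"] simp: ennreal_neg\<close>)
    have le: "ennreal (\<nu> X) + ennreal (\<nu> Y) \<le> P (A \<union> B)"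
      if "X \<in> sets M" "X \<subseteq> A" "Y \<in> sets M" "Y \<subseteq> B" for X Y
    proof -
      obtain X' Y' where *: "X' \<in> sets M" "X' \<subseteq> A" "\<nu> X' \<ge> 0" "ennreal (\<nu> X) \<le> ennreal (\<nu> X')"
        "Y' \<in> sets M" "Y' \<subseteq> B" "\<nu> Y' \<ge> 0" "ennreal (\<nu> Y) \<le> ennreal (\<nu> Y')"
        using nonneg \<open>X \<in> sets M\<close> \<open>X \<subseteq> A\<close> \<open>Y \<in> sets M\<close> \<open>Y \<subseteq> B\<close> by metis
      have "ennreal (\<nu> X) + ennreal (\<nu> Y) \<le> ennreal (\<nu> X') + ennreal (\<nu> Y')"
        using * by (intro add_mono)
      also have "\<dots> = ennreal (\<nu> (X' \<union> Y'))"
        using * \<open>A \<inter> B = {}\<close> by (subst signed_measure_Un[OF \<nu>]) (auto simp: ennreal_plus)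
      also have "\<dots> \<le> P (A \<union> B)" using * by (intro upper) auto
      finally show ?thesis .
    qed
    have ne: "{B \<in> sets M. B \<subseteq> A} \<noteq> {}" for A by auto
    have "P A + P B = (SUP X\<in>{B \<in> sets M. B \<subseteq> A}. ennreal (\<nu> X) + P B)"
      unfolding P_def[of A] by (rule ennreal_SUP_add_left[symmetric, OF ne])
    also have "\<dots> = (SUP X\<in>{B \<in> sets M. B \<subseteq> A}. SUP Y\<in>{Y \<in> sets M. Y \<subseteq> B}. ennreal (\<nu> X) + ennreal (\<nu> Y))"
      unfolding P_def[of B] by (subst ennreal_SUP_add_right[OF ne]) auto
    also have "\<dots> \<le> P (A \<union> B)" using le by (intro SUP_least) auto
    finally show ?thesis .
  qed
  have "P {} = 0"
    unfolding P_def by (auto simp: signed_measure_empty[OF \<nu>] bot_ennreal intro!: antisym SUP_least)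
  then have pos: "positive (sets M) P"
    by (simp add: positive_def)
  have ca: "countably_additive (sets M) P"
  proof (rule countably_additiveI, rule antisym)
    fix A :: "nat \<Rightarrow> 'a set"
    assume A: "range A \<subseteq> sets M" "disjoint_family A" "(\<Union>i. A i) \<in> sets M"
    have fin: "(\<Sum>i<n. P (A i)) \<le> P (\<Union>i<n. A i)" for n
    proof (induction n)
      case (Suc n)
      have "(\<Union>i<n. A i) \<inter> A n = {}"
        using disjoint_family_onD[OF A(2), of _ n] by force
      then have "P (\<Union>i<n. A i) + P (A n) \<le> P ((\<Union>i<n. A i) \<union> A n)"
        by (rule super)
      then show ?case
        using order_trans[OF add_right_mono[OF Suc, of "P (A n)"]] by (simp add: lessThan_Suc Un_commute add.commute)
    qed simp
    show "(\<Sum>i. P (A i)) \<le> P (\<Union>i. A i)"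
      unfolding suminf_eq_SUP by (intro SUP_least order_trans[OF fin] mono) auto
    show "P (\<Union>i. A i) \<le> (\<Sum>i. P (A i))"
      unfolding P_def[of "\<Union>i. A i"]
    proof (rule SUP_least, clarify)
      fix B assume B: "B \<in> sets M" "B \<subseteq> (\<Union>i. A i)"
      \<comment> \<open>The terms of this real series may have both signs; its partial sums are
        bounded through the truncated terms before the limit is taken.\<close>
      have "(\<lambda>i. \<nu> (B \<inter> A i)) sums \<nu> (\<Union>i. B \<inter> A i)"
        using A B by (intro \<nu>[unfolded signed_measure_def, rule_format])
          (auto simp: disjoint_family_on_def)
      moreover have "(\<Union>i. B \<inter> A i) = B" using B by auto
      ultimately have "(\<lambda>n. ennreal (\<Sum>i<n. \<nu> (B \<inter> A i))) \<longlonglongrightarrow> ennreal (\<nu> B)"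
        unfolding sums_def by (intro tendsto_ennrealI) simp
      moreover have "ennreal (\<Sum>i<n. \<nu> (B \<inter> A i)) \<le> (\<Sum>i. P (A i))" for n
      proof -
        have "ennreal (\<Sum>i<n. \<nu> (B \<inter> A i)) \<le> ennreal (\<Sum>i<n. max 0 (\<nu> (B \<inter> A i)))"
          by (intro ennreal_leI sum_mono) auto
        also have "\<dots> = (\<Sum>i<n. ennreal (max 0 (\<nu> (B \<inter> A i))))"
          by (subst sum_ennreal) auto
        also have "\<dots> = (\<Sum>i<n. ennreal (\<nu> (B \<inter> A i)))"
          by (intro sum.cong refl) (auto simp: max_def ennreal_neg)
        also have "\<dots> \<le> (\<Sum>i<n. P (A i))"
          using A B by (intro sum_mono upper) auto
        also have "\<dots> \<le> (\<Sum>i. P (A i))"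
          by (intro sum_le_suminf) auto
        finally show ?thesis .
      qed
      ultimately show "ennreal (\<nu> B) \<le> (\<Sum>i. P (A i))"
        by (intro LIMSEQ_le_const2[of _ "ennreal (\<nu> B)"]) auto
    qed
  qed
  show ?thesis
    using emeasure_measure_of_sigma[OF sets.sigma_algebra_axioms pos ca A]
    unfolding P_def positive_part_def .
qed

lemma finite_measure_positive_part:
  assumes \<nu>: "signed_measure M \<nu>"
  shows "finite_measure (positive_part M \<nu>)"
proof (rule finite_measureI)
  obtain C where C: "\<And>B. B \<in> sets M \<Longrightarrow> \<bar>\<nu> B\<bar> \<le> C"
    using signed_measure_bounded[OF \<nu>] by blast
  have "emeasure (positive_part M \<nu>) (space M) \<le> ennreal C"
    unfolding emeasure_positive_part[OF \<nu> sets.top]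
    using C by (intro SUP_least ennreal_leI) (fastforce simp: abs_le_iff)
  then have "emeasure (positive_part M \<nu>) (space M) < \<infinity>"
    by (rule le_less_trans) simp
  then show "emeasure (positive_part M \<nu>) (space (positive_part M \<nu>)) \<noteq> \<infinity>"
    by simp
qed

text \<open>One inequality, applied to \<open>\<nu>\<close> and to its negative, gives the equality.
  It comes from complements: for \<open>B\<close> inside \<open>A\<close>, \<open>- \<nu> B\<close>
  equals \<open>\<nu> (A - B) - \<nu> A\<close>, and \<open>\<nu> (A - B)\<close> is at most the
  positive part of \<open>A\<close>.\<close>

lemma Jordan_decomposition:
  assumes \<nu>: "signed_measure M \<nu>" and A: "A \<in> sets M"
  shows "\<nu> A = measure (positive_part M \<nu>) A - measure (positive_part M (\<lambda>A. - \<nu> A)) A"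
proof -
  have le: "\<nu> A + measure (positive_part M (\<lambda>A. - \<nu> A)) A \<le> measure (positive_part M \<nu>) A"
    if \<nu>: "signed_measure M \<nu>" for \<nu> :: "'a set \<Rightarrow> real"
  proof -
    interpret p: finite_measure "positive_part M \<nu>"
      by (rule finite_measure_positive_part[OF \<nu>])
    interpret n: finite_measure "positive_part M (\<lambda>A. - \<nu> A)"
      by (rule finite_measure_positive_part[OF signed_measure_uminus[OF \<nu>]])
    have up: "\<nu> B \<le> measure (positive_part M \<nu>) A" if "B \<in> sets M" "B \<subseteq> A" for B
    proof -
      have "ennreal (\<nu> B) \<le> emeasure (positive_part M \<nu>) A"
        unfolding emeasure_positive_part[OF \<nu> A] using that by (intro SUP_upper) auto
      then show ?thesis
        by (simp add: p.emeasure_eq_measure ennreal_le_iff2) (use measure_nonneg in \<open>smt (verit)\<close>)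
    qed
    have "emeasure (positive_part M (\<lambda>A. - \<nu> A)) A \<le> ennreal (measure (positive_part M \<nu>) A - \<nu> A)"
      unfolding emeasure_positive_part[OF signed_measure_uminus[OF \<nu>] A]
    proof (rule SUP_least, clarify, rule ennreal_leI)
      fix B assume B: "B \<in> sets M" "B \<subseteq> A"
      show "- \<nu> B \<le> measure (positive_part M \<nu>) A - \<nu> A"
        using up[of "A - B"] B A signed_measure_Diff[OF \<nu> A B] by auto
    qed
    moreover have "measure (positive_part M \<nu>) A - \<nu> A \<ge> 0" using up[OF A] by simp
    ultimately show ?thesis by (simp add: n.emeasure_eq_measure)
  qed
  show ?thesis
    using le[OF \<nu>] le[OF signed_measure_uminus[OF \<nu>]] by simp
qed

text \<open>The hypothesis is the case of indicator functions, and induction over nonnegative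
  measurable functions carries it to bounded ones. Thus different representations of one signed
  measure by finite measures integrate bounded functions alike.\<close>

lemma integral_combination_eq_0:
  fixes \<mu> :: "'i \<Rightarrow> 'a measure" and c :: "'i \<Rightarrow> real"
  assumes I: "finite I"
    and fin: "\<And>i. i \<in> I \<Longrightarrow> finite_measure (\<mu> i)"
    and sets: "\<And>i. i \<in> I \<Longrightarrow> sets (\<mu> i) = sets M"
    and zero: "\<And>A. A \<in> sets M \<Longrightarrow> (\<Sum>i\<in>I. c i * measure (\<mu> i) A) = 0"
    and f: "f \<in> borel_measurable M" "\<And>x. x \<in> space M \<Longrightarrow> \<bar>f x\<bar> \<le> B"
  shows "(\<Sum>i\<in>I. c i * (\<integral>x. f x \<partial>\<mu> i)) = 0"
proof -
  have spc: "space (\<mu> i) = space M" if "i \<in> I" for i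
    using sets[OF that] by (rule sets_eq_imp_space_eq)
  have int: "integrable (\<mu> i) g"
    if "i \<in> I" "g \<in> borel_measurable M" "\<And>x. x \<in> space M \<Longrightarrow> \<bar>g x\<bar> \<le> B" for i B and g :: "'a \<Rightarrow> real"
  proof -
    interpret finite_measure "\<mu> i" using fin that by blast
    show ?thesis
      using that spc sets by (intro integrable_const_bound[of _ B] AE_I2) (auto cong: measurable_cong_sets)
  qed
  \<comment> \<open>Boundedness is an implication inside the induction, with \<open>B\<close>
    arbitrary: the step for \<open>k * u\<close> uses the bound \<open>B / k\<close> for
    \<open>u\<close>, and in the limit step the constant \<open>B\<close> dominates the
    approximants.\<close>
  have nonneg: "(\<forall>x\<in>space M. g x \<le> B) \<longrightarrow> (\<Sum>i\<in>I. c i * (\<integral>x. g x \<partial>\<mu> i)) = 0"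
    if g: "g \<in> borel_measurable M" "\<And>x. 0 \<le> g x" for g :: "'a \<Rightarrow> real" and B
    using g
  proof (induction arbitrary: B rule: borel_measurable_induct_real)
    case (set A)
    have "(\<integral>x. indicator A x \<partial>\<mu> i) = measure (\<mu> i) A" if "i \<in> I" for i
      using set sets that spc by (simp add: sets.Int_space_eq2)
    then show ?case using zero[OF set] by (simp cong: sum.cong)
  next
    case (mult u k)
    show ?case
    proof (cases "k = 0")
      case False
      show ?thesis
      proof
        assume "\<forall>x\<in>space M. k * u x \<le> B"
        then have "\<forall>x\<in>space M. u x \<le> B / k"
          using False mult by (simp add: field_simps)
        then have "(\<Sum>i\<in>I. c i * (\<integral>x. u x \<partial>\<mu> i)) = 0" using mult by blast
        then have "k * (\<Sum>i\<in>I. c i * (\<integral>x. u x \<partial>\<mu> i)) = 0" by simp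
        then show "(\<Sum>i\<in>I. c i * (\<integral>x. k * u x \<partial>\<mu> i)) = 0"
          by (simp add: sum_distrib_left mult.left_commute)
      qed
    qed simp
  next
    case (add u v)
    show ?case
    proof
      assume "\<forall>x\<in>space M. v x + u x \<le> B"
      then have b: "\<forall>x\<in>space M. u x \<le> B" "\<forall>x\<in>space M. v x \<le> B"
        using add by (smt (verit))+
      have "(\<integral>x. v x + u x \<partial>\<mu> i) = (\<integral>x. v x \<partial>\<mu> i) + (\<integral>x. u x \<partial>\<mu> i)" if "i \<in> I" for i
        using b add that by (intro Bochner_Integration.integral_add int[where B = B]) auto
      then show "(\<Sum>i\<in>I. c i * (\<integral>x. v x + u x \<partial>\<mu> i)) = 0"
        using add b by (simp add: distrib_left sum.distrib cong: sum.cong)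
    qed
  next
    case (seq U)
    show ?case
    proof
      assume b: "\<forall>x\<in>space M. g x \<le> B"
      have Ule: "U n x \<le> B" if "x \<in> space M" for n x
      proof -
        have "incseq (\<lambda>n. U n x)" using \<open>incseq U\<close> by (auto simp: incseq_def le_fun_def)
        then have "U n x \<le> g x" using incseq_le[of "\<lambda>n. U n x" "g x" n] seq that by blast
        then show ?thesis using b that by force
      qed
      have meas: "g \<in> borel_measurable M"
        by (rule borel_measurable_LIMSEQ_real[where u = U]) (use seq in auto)
      have "(\<lambda>n. \<integral>x. U n x \<partial>\<mu> i) \<longlonglongrightarrow> (\<integral>x. g x \<partial>\<mu> i)" if i: "i \<in> I" for i
      proof (rule integral_dominated_convergence[where w = "\<lambda>_. B"])
        show "integrable (\<mu> i) (\<lambda>_. B)" using int[OF i, of "\<lambda>_. B" "\<bar>B\<bar>"] by simp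
      qed (use seq meas i Ule spc sets in \<open>auto cong: measurable_cong_sets intro!: AE_I2\<close>)
      then have "(\<lambda>n. \<Sum>i\<in>I. c i * (\<integral>x. U n x \<partial>\<mu> i)) \<longlonglongrightarrow> (\<Sum>i\<in>I. c i * (\<integral>x. g x \<partial>\<mu> i))"
        by (intro tendsto_sum tendsto_mult tendsto_const)
      moreover have "(\<Sum>i\<in>I. c i * (\<integral>x. U n x \<partial>\<mu> i)) = 0" for n
        using seq Ule by blast
      ultimately show "(\<Sum>i\<in>I. c i * (\<integral>x. g x \<partial>\<mu> i)) = 0"
        by (simp add: LIMSEQ_const_iff)
    qed
  qed
  have meas[measurable]: "f \<in> borel_measurable M" by fact
  have pn: "(\<Sum>i\<in>I. c i * (\<integral>x. max 0 (f x) \<partial>\<mu> i)) = 0" "(\<Sum>i\<in>I. c i * (\<integral>x. max 0 (- f x) \<partial>\<mu> i)) = 0"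
    by (rule nonneg[rule_format, where B = "\<bar>B\<bar>"]; use f in force)+
  have "(\<integral>x. f x \<partial>\<mu> i) = (\<integral>x. max 0 (f x) \<partial>\<mu> i) - (\<integral>x. max 0 (- f x) \<partial>\<mu> i)" if i: "i \<in> I" for i
    by (subst Bochner_Integration.integral_diff[symmetric])
       (use f in \<open>force intro!: int[OF i, where B = "\<bar>B\<bar>"] Bochner_Integration.integral_cong\<close>)+
  then have "(\<Sum>i\<in>I. c i * (\<integral>x. f x \<partial>\<mu> i)) =
      (\<Sum>i\<in>I. c i * (\<integral>x. max 0 (f x) \<partial>\<mu> i)) - (\<Sum>i\<in>I. c i * (\<integral>x. max 0 (- f x) \<partial>\<mu> i))"
    by (simp add: right_diff_distrib sum_subtractf cong: sum.cong)
  then show ?thesis using pn by simp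
qed

lemma signed_measure_combination:
  fixes \<mu> :: "'i \<Rightarrow> 'a measure" and c :: "'i \<Rightarrow> real"
  assumes "\<And>i. i \<in> I \<Longrightarrow> finite_measure (\<mu> i)"
    and "\<And>i. i \<in> I \<Longrightarrow> sets (\<mu> i) = sets M"
  shows "signed_measure M (\<lambda>A. \<Sum>i\<in>I. c i * measure (\<mu> i) A)"
  unfolding signed_measure_def
proof (intro allI impI sums_sum sums_mult, elim conjE)
  fix A :: "nat \<Rightarrow> 'a set" and i assume *: "i \<in> I" "range A \<subseteq> sets M" "disjoint_family A"
  interpret finite_measure "\<mu> i" using assms * by blast
  show "(\<lambda>n. measure (\<mu> i) (A n)) sums measure (\<mu> i) (\<Union>n. A n)"
    using * assms by (intro finite_measure_UNION) auto
qed

text \<open>The two parts of the Jordan decomposition are adjoined to the family with coefficients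
  -1 and 1. The enlarged combination vanishes on all measurable sets, hence integrates bounded
  functions to 0.\<close>

lemma signed_integral_combination:
  fixes \<mu> :: "'i \<Rightarrow> 'a measure" and c :: "'i \<Rightarrow> real"
  assumes I: "finite I"
    and fin: "\<And>i. i \<in> I \<Longrightarrow> finite_measure (\<mu> i)"
    and sets: "\<And>i. i \<in> I \<Longrightarrow> sets (\<mu> i) = sets M"
    and f: "f \<in> borel_measurable M" "\<And>x. x \<in> space M \<Longrightarrow> \<bar>f x\<bar> \<le> B"
  shows "signed_integral M (\<lambda>A. \<Sum>i\<in>I. c i * measure (\<mu> i) A) f = (\<Sum>i\<in>I. c i * (\<integral>x. f x \<partial>\<mu> i))"
proof -
  define \<nu> where "\<nu> A = (\<Sum>i\<in>I. c i * measure (\<mu> i) A)" for A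
  have \<nu>: "signed_measure M \<nu>"
    unfolding \<nu>_def[abs_def] using fin sets by (rule signed_measure_combination)
  define \<kappa> where "\<kappa> = case_sum \<mu> (\<lambda>b. if b then positive_part M \<nu> else positive_part M (\<lambda>A. - \<nu> A))"
  define d where "d = case_sum c (\<lambda>b. if b then -1 else 1)"
  have "(\<Sum>j\<in>I <+> UNIV. d j * (\<integral>x. f x \<partial>\<kappa> j)) = 0"
  proof (rule integral_combination_eq_0[OF _ _ _ _ f])
    show "finite_measure (\<kappa> j)" "sets (\<kappa> j) = sets M" if "j \<in> I <+> UNIV" for j
      using that fin sets finite_measure_positive_part[OF \<nu>]
        finite_measure_positive_part[OF signed_measure_uminus[OF \<nu>]] by (auto simp: \<kappa>_def split: if_splits)
    show "(\<Sum>j\<in>I <+> UNIV. d j * measure (\<kappa> j) A) = 0" if "A \<in> sets M" for A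
      using Jordan_decomposition[OF \<nu> that]
      by (simp add: sum.Plus I UNIV_bool \<kappa>_def d_def \<nu>_def)
  qed (use I in auto)
  then show ?thesis
    by (simp add: sum.Plus I UNIV_bool \<kappa>_def d_def signed_integral_def \<nu>_def[abs_def])
qed

text \<open>By Fubini, both constants are the double integral of \<open>r\<close> against \<open>\<nu>\<^sub>1\<close> and \<open>\<nu>\<^sub>2\<close>.\<close>

lemma signed_integral_symmetric_kernel_unique:
  fixes r :: "'a \<Rightarrow> 'a \<Rightarrow> real"
  assumes r: "case_prod r \<in> borel_measurable (M \<Otimes>\<^sub>M M)"
    and bound: "\<And>x y. x \<in> space M \<Longrightarrow> y \<in> space M \<Longrightarrow> \<bar>r x y\<bar> \<le> B"
    and symm: "\<And>x y. x \<in> space M \<Longrightarrow> y \<in> space M \<Longrightarrow> r x y = r y x"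
    and \<nu>: "signed_measure M \<nu>1" "\<nu>1 (space M) = 1" "signed_measure M \<nu>2" "\<nu>2 (space M) = 1"
    and c1: "\<And>x. x \<in> space M \<Longrightarrow> signed_integral M \<nu>1 (r x) = c1"
    and c2: "\<And>x. x \<in> space M \<Longrightarrow> signed_integral M \<nu>2 (r x) = c2"
  shows "c1 = c2"
proof -
  let ?P = "positive_part M"
  let ?n = "\<lambda>\<nu> A. - \<nu> A :: real"
  have int: "integrable (?P \<nu>) (\<lambda>x. \<integral>y. r x y \<partial>?P \<nu>')"
    and Fubini: "(\<integral>y. (\<integral>x. r x y \<partial>?P \<nu>) \<partial>?P \<nu>') = (\<integral>x. (\<integral>y. r x y \<partial>?P \<nu>') \<partial>?P \<nu>)"
    if \<nu>: "signed_measure M \<nu>" and \<nu>': "signed_measure M \<nu>'" for \<nu> \<nu>'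
  proof -
    interpret p: finite_measure "?P \<nu>" by (rule finite_measure_positive_part[OF \<nu>])
    interpret q: finite_measure "?P \<nu>'" by (rule finite_measure_positive_part[OF \<nu>'])
    interpret pq: pair_sigma_finite "?P \<nu>" "?P \<nu>'" ..
    interpret fpq: finite_measure "?P \<nu> \<Otimes>\<^sub>M ?P \<nu>'"
      by (intro finite_measure_pair_measure p.finite_measure_axioms q.finite_measure_axioms)
    have int: "integrable (?P \<nu> \<Otimes>\<^sub>M ?P \<nu>') (case_prod r)"
    proof (rule fpq.integrable_const_bound[where B = B])
      show "AE x in ?P \<nu> \<Otimes>\<^sub>M ?P \<nu>'. norm (case_prod r x) \<le> B"
        by (rule AE_I2) (auto simp: space_pair_measure bound)
      have "sets (?P \<nu> \<Otimes>\<^sub>M ?P \<nu>') = sets (M \<Otimes>\<^sub>M M)"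
        by (rule sets_pair_measure_cong) auto
      then show "case_prod r \<in> borel_measurable (?P \<nu> \<Otimes>\<^sub>M ?P \<nu>')"
        using r by (simp cong: measurable_cong_sets)
    qed
    show "integrable (?P \<nu>) (\<lambda>x. \<integral>y. r x y \<partial>?P \<nu>')"
      using pq.integrable_fst[OF int] .
    show "(\<integral>y. (\<integral>x. r x y \<partial>?P \<nu>) \<partial>?P \<nu>') = (\<integral>x. (\<integral>y. r x y \<partial>?P \<nu>') \<partial>?P \<nu>)"
      using pq.Fubini_integral[OF int] .
  qed
  \<comment> \<open>Fubini exchanges the integrals, and the symmetry of \<open>r\<close> then
    exchanges its arguments, so that the inner integral is again one of some
    \<open>r y\<close>.\<close>
  have swap: "(\<integral>x. (\<integral>y. r x y \<partial>?P \<nu>') \<partial>?P \<nu>) = (\<integral>y. (\<integral>x. r y x \<partial>?P \<nu>) \<partial>?P \<nu>')"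
    if "signed_measure M \<nu>" "signed_measure M \<nu>'" for \<nu> \<nu>'
    unfolding Fubini[OF that, symmetric]
    by (intro Bochner_Integration.integral_cong refl) (rule symm, simp_all)
  note m = \<nu>(1,3) \<nu>(1,3)[THEN signed_measure_uminus]
  have const: "signed_integral M \<nu> (\<lambda>_. c) = c" if "signed_measure M \<nu>" "\<nu> (space M) = 1" for \<nu> c
    using Jordan_decomposition[OF that(1) sets.top] that(2)
    by (simp add: signed_integral_def flip: right_diff_distrib left_diff_distrib)
  have "c2 = signed_integral M \<nu>1 (\<lambda>x. c2)" by (simp add: const \<nu>)
  also have "\<dots> = signed_integral M \<nu>1 (\<lambda>x. signed_integral M \<nu>2 (r x))"
    unfolding signed_integral_def[of M \<nu>1]
    by (intro arg_cong2[where f = "(-)"] Bochner_Integration.integral_cong) (simp_all add: c2)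
  \<comment> \<open>Expanding both signed integrals gives four double integrals over positive and
    negative parts, each of which is swapped.\<close>
  also have "\<dots> = signed_integral M \<nu>2 (\<lambda>y. signed_integral M \<nu>1 (r y))"
    by (simp add: signed_integral_def int m swap[of \<nu>1] swap[of "?n \<nu>1"] Bochner_Integration.integral_diff)
  also have "\<dots> = signed_integral M \<nu>2 (\<lambda>_. c1)"
    unfolding signed_integral_def[of M \<nu>2]
    by (intro arg_cong2[where f = "(-)"] Bochner_Integration.integral_cong) (simp_all add: c1)
  also have "\<dots> = c1" by (simp add: const \<nu>)
  finally show ?thesis by simp
qed

lemma signed_integral_cong:
  assumes "\<And>x. x \<in> space M \<Longrightarrow> f x = g x"
  shows "signed_integral M \<nu> f = signed_integral M \<nu> g"
  unfolding signed_integral_def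
  by (intro arg_cong2[where f = "(-)"] Bochner_Integration.integral_cong) (simp_all add: assms)

section \<open>The pseudo inverse of the discrete Laplacian\<close>

lemma matrix_add_rdistrib:
  fixes C :: "'a::semiring_1 ^ 'n ^ 'm"
  shows "(A + B) ** C = A ** C + B ** C"
  by (simp add: matrix_matrix_mult_def vec_eq_iff algebra_simps sum.distrib)

lemma matrix_diff_ldistrib:
  fixes C :: "'a::ring_1 ^ 'n ^ 'm"
  shows "A ** (B - C) = A ** B - A ** C"
  by (simp add: matrix_matrix_mult_def vec_eq_iff algebra_simps sum_subtractf)

lemma matrix_diff_rdistrib:
  fixes C :: "'a::ring_1 ^ 'n ^ 'm"
  shows "(A - B) ** C = A ** C - B ** C"
  by (simp add: matrix_matrix_mult_def vec_eq_iff algebra_simps sum_subtractf)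

text \<open>\<open>A ** X\<close> and \<open>A ** Y\<close> are both the orthogonal projection onto
  the range of \<open>A\<close>: each acts as the identity on the other, and transposing the product
  of the two symmetric matrices exchanges the factors.\<close>

lemma is_pseudo_inverse_mult_unique:
  assumes "is_pseudo_inverse A X" "is_pseudo_inverse A Y"
  shows "A ** X = A ** Y"
proof -
  note X = assms(1)[unfolded is_pseudo_inverse_def] and Y = assms(2)[unfolded is_pseudo_inverse_def]
  have "A ** X = A ** Y ** A ** X" using Y by simp
  also have "\<dots> = (A ** Y) ** (A ** X)" by (simp add: matrix_mul_assoc)
  also have "\<dots> = transpose (A ** Y) ** transpose (A ** X)" using X Y by simp
  also have "\<dots> = transpose (A ** X ** (A ** Y))" by (rule matrix_transpose_mul[symmetric])
  also have "\<dots> = transpose (A ** X ** A ** Y)" by (simp add: matrix_mul_assoc)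
  also have "\<dots> = A ** Y" using X Y by simp
  finally show ?thesis .
qed

text \<open>Transposition turns the preceding uniqueness into that of \<open>X ** A\<close>, and the
  two projections determine \<open>X\<close> because \<open>X = X ** A ** X\<close>.\<close>

lemma is_pseudo_inverse_unique:
  assumes X: "is_pseudo_inverse A X" and Y: "is_pseudo_inverse A Y"
  shows "X = Y"
proof -
  have "is_pseudo_inverse (transpose A) (transpose Z)" if "is_pseudo_inverse A Z" for Z
    using that unfolding is_pseudo_inverse_def
    by (metis matrix_mul_assoc matrix_transpose_mul transpose_transpose)
  from is_pseudo_inverse_mult_unique[OF this[OF X] this[OF Y]] have "transpose (X ** A) = transpose (Y ** A)"
    by (simp only: matrix_transpose_mul)
  then have right: "X ** A = Y ** A" by simp
  have "X = X ** A ** X" using X by (simp add: is_pseudo_inverse_def)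
  also have "\<dots> = X ** (A ** Y)" by (simp add: is_pseudo_inverse_mult_unique[OF X Y] flip: matrix_mul_assoc)
  also have "\<dots> = Y ** A ** Y" by (simp add: right matrix_mul_assoc)
  also have "\<dots> = Y" using Y by (simp add: is_pseudo_inverse_def)
  finally show ?thesis .
qed

lemma pseudo_inverse_eqI: "is_pseudo_inverse A X \<Longrightarrow> pseudo_inverse A = X"
  unfolding pseudo_inverse_def by (rule the_equality) (auto intro: is_pseudo_inverse_unique)

text \<open>\<open>P\<close> is the orthogonal projection onto the constant vectors, which form the
  kernel of \<open>A\<close>. Hence \<open>A + P\<close> is invertible, and its inverse minus
  \<open>P\<close> is the pseudo inverse: it inverts \<open>A\<close> on the complement of the
  constants and annihilates the constants.\<close>

lemma pseudo_inverse_of_constant_kernel: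
  fixes A :: "real ^ 'n ^ 'n"
  defines "P \<equiv> (\<chi> i j. 1 / real CARD('n)) :: real ^ 'n ^ 'n"
  assumes sym: "transpose A = A"
    and const: "A *v (\<chi> i. 1) = 0"
    and ker: "\<And>x i j. A *v x = 0 \<Longrightarrow> x $ i = x $ j"
  shows "A ** pseudo_inverse A = mat 1 - P"
    and "transpose (pseudo_inverse A) = pseudo_inverse A"
    and "P ** pseudo_inverse A = 0"
proof -
  have tP: "transpose P = P" by (simp add: P_def transpose_def)
  have AP: "A ** P = 0"
    using const by (simp add: P_def vec_eq_iff matrix_matrix_mult_def matrix_vector_mult_def flip: sum_divide_distrib)
  have PA: "P ** A = 0"
    using arg_cong[OF AP, of transpose] by (simp add: matrix_transpose_mul sym tP) (simp add: transpose_def vec_eq_iff)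
  have PP: "P ** P = P"
    by (simp add: P_def vec_eq_iff matrix_matrix_mult_def)
  have inj: "x = 0" if "(A + P) *v x = 0" for x
  proof -
    \<comment> \<open>Applying \<open>P\<close> shows that \<open>x\<close> has mean 0. Then
      \<open>A *v x\<close> vanishes as well, so \<open>x\<close> is constant and equal to its own
      mean.\<close>
    have "P *v ((A + P) *v x) = P *v x"
      by (simp add: matrix_vector_mul_assoc matrix_add_ldistrib PA PP)
    then have Px: "P *v x = 0" using that by simp
    then have "A *v x = 0" using that by (simp add: matrix_vector_mult_add_rdistrib)
    then have c: "x $ j = x $ i" for i j by (rule ker)
    have "(\<Sum>j\<in>UNIV. x $ j) = (\<Sum>j\<in>(UNIV :: 'n set). x $ i)" for i by (rule sum.cong[OF refl c])
    then have s: "(\<Sum>j\<in>UNIV. x $ j) = real CARD('n) * x $ i" for i by simp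
    have "(P *v x) $ i = x $ i" for i
      using s[of i] by (simp add: P_def matrix_vector_mult_def flip: sum_divide_distrib)
    then show ?thesis using Px by (simp add: vec_eq_iff)
  qed
  have "\<exists>B. B ** (A + P) = mat 1"
    unfolding matrix_left_invertible_ker by (intro allI impI) (rule inj)
  then obtain B where BM: "B ** (A + P) = mat 1" ..
  then have MB: "(A + P) ** B = mat 1" by (rule matrix_left_right_inverse[THEN iffD1])
  have "B ** P = B ** ((A + P) ** P)" by (simp add: matrix_add_rdistrib AP PP)
  then have BP: "B ** P = P" by (simp add: matrix_mul_assoc BM)
  have "P ** B = (P ** (A + P)) ** B" by (simp add: matrix_add_ldistrib PA PP)
  then have PB: "P ** B = P" by (simp add: MB flip: matrix_mul_assoc)
  define K where "K = B - P"
  have AK: "A ** K = mat 1 - P"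
    using MB by (simp add: K_def matrix_diff_ldistrib matrix_add_rdistrib AP PB algebra_simps)
  have KA: "K ** A = mat 1 - P"
    using BM by (simp add: K_def matrix_diff_rdistrib matrix_add_ldistrib PA BP algebra_simps)
  have t: "transpose (mat 1 - P) = mat 1 - P"
    by (simp add: vec_eq_iff transpose_def P_def mat_def)
  have K: "is_pseudo_inverse A K"
    by (simp add: is_pseudo_inverse_def AK KA t matrix_diff_rdistrib PA)
       (simp add: K_def matrix_diff_ldistrib matrix_diff_rdistrib PB PP)
  then have pinv: "pseudo_inverse A = K" by (rule pseudo_inverse_eqI)
  \<comment> \<open>The defining equations are stable under transposition because \<open>A\<close>
    is symmetric; uniqueness then makes \<open>K\<close> symmetric.\<close>
  have "is_pseudo_inverse A (transpose K)"
    using K sym unfolding is_pseudo_inverse_def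
    by (metis matrix_mul_assoc matrix_transpose_mul transpose_transpose)
  then have "transpose K = K" using K is_pseudo_inverse_unique by blast
  then show "transpose (pseudo_inverse A) = pseudo_inverse A"
    and "A ** pseudo_inverse A = mat 1 - P"
    and "P ** pseudo_inverse A = 0"
    using AK by (simp_all add: pinv) (simp add: K_def matrix_diff_ldistrib PB PP)
qed

text \<open>Connectedness is reachability in the symmetrized digraph, and the hypothesis on arcs
  reads the same for a reversed arc, so induction along a path applies.\<close>

lemma connected_imp_constant:
  assumes "Digraph_Component.connected G" "u \<in> verts G" "v \<in> verts G"
    and "\<And>e. e \<in> arcs G \<Longrightarrow> h (tail G e) = h (head G e)"
  shows "h u = h v"
proof -
  have "(u, v) \<in> rtrancl_on (verts G) (arcs_ends (with_proj (mk_symmetric G)))"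
    using assms by (simp add: Digraph_Component.connected_def strongly_connected_def reachable_def mk_symmetric_def)
  then show ?thesis
  proof (induction rule: rtrancl_on_induct)
    case (step y z)
    then show ?case
      using assms(4) by (auto simp: arcs_ends_conv mk_symmetric_def)
  qed simp
qed

section \<open>The Laplacian as a weighted sum over the arcs\<close>

locale optimal_metrized_graph =
  fixes G :: "('v::finite, 'e) pre_digraph" and len :: "'e \<Rightarrow> real"
  assumes metrized: "metrized_graph G len"
    and optimal: "optimal_vertex_set G"
    and verts_UNIV: "verts G = UNIV"
begin

abbreviation lap where "lap \<equiv> discrete_laplacian G len"
abbreviation pinv where "pinv \<equiv> pseudo_inverse lap"
abbreviation "t \<equiv> tail G"
abbreviation "h \<equiv> head G"

lemma finite_arcs [simp]: "finite (arcs G)"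
  using metrized unfolding metrized_graph_def fin_digraph_def fin_digraph_axioms_def by blast

lemma len_pos [simp]: "e \<in> arcs G \<Longrightarrow> 0 < len e"
  using metrized by (simp add: metrized_graph_def)

lemma len_nonzero [simp]: "e \<in> arcs G \<Longrightarrow> len e \<noteq> 0"
  by (metis len_pos less_irrefl)

lemma loopfree: "e \<in> arcs G \<Longrightarrow> t e \<noteq> h e"
  using optimal by (simp add: optimal_vertex_set_def)

lemma joins_unique: "joins G e p q \<Longrightarrow> joins G e' p q \<Longrightarrow> e' = e"
  using optimal unfolding optimal_vertex_set_def by blast

text \<open>Row \<open>e\<close> of the signed incidence matrix. The Laplacian is a sum of products
  of two entries of the same row, in which the orientation of the arc cancels.\<close>

definition incidence :: "'e \<Rightarrow> 'v \<Rightarrow> real" where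
  "incidence e p = of_bool (p = h e) - of_bool (p = t e)"

lemma sum_incidence: "(\<Sum>p\<in>UNIV. incidence e p * f p) = f (h e) - f (t e)"
  by (simp add: incidence_def left_diff_distrib sum_subtractf)

text \<open>For distinct \<open>p\<close> and \<open>q\<close> the product of the entries is -1 on
  arcs joining them and 0 on all others, and optimality leaves at most one such arc.\<close>

lemma laplacian_entry_eq:
  assumes "p \<noteq> q"
  shows "laplacian_entry G len p q = (\<Sum>e\<in>arcs G. incidence e p * incidence e q / len e)"
proof -
  have *: "incidence e p * incidence e q = (if joins G e p q then -1 else 0)" if "e \<in> arcs G" for e
    using assms that loopfree[OF that] by (auto simp: incidence_def joins_def doubleton_eq_iff)
  show ?thesis
  proof (cases "\<exists>e. joins G e p q")
    case True
    then obtain e0 where e0: "joins G e0 p q" by blast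
    have "(\<Sum>e\<in>arcs G. incidence e p * incidence e q / len e) = (\<Sum>e\<in>arcs G. if e = e0 then - 1 / len e0 else 0)"
      using e0 joins_unique by (intro sum.cong refl) (auto simp: *)
    moreover have "e0 \<in> arcs G" using e0 by (simp add: joins_def)
    moreover have "(THE e. joins G e p q) = e0" using e0 joins_unique by blast
    ultimately show ?thesis using True by (simp add: laplacian_entry_def)
  qed (simp add: laplacian_entry_def * cong: sum.cong)
qed

text \<open>For the diagonal: every incidence row sums to 0, so the terms with \<open>s\<close>
  different from \<open>p\<close> add up to minus the term at \<open>p\<close>.\<close>

lemma laplacian_eq: "lap $ p $ q = (\<Sum>e\<in>arcs G. incidence e p * incidence e q / len e)"
proof (cases "p = q")
  case True
  have "(\<Sum>s\<in>UNIV - {p}. laplacian_entry G len p s) =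
      (\<Sum>s\<in>UNIV - {p}. \<Sum>e\<in>arcs G. incidence e p * incidence e s / len e)"
    by (intro sum.cong refl laplacian_entry_eq) auto
  also have "\<dots> = (\<Sum>e\<in>arcs G. \<Sum>s\<in>UNIV - {p}. incidence e p * incidence e s / len e)"
    by (rule sum.swap)
  also have "\<dots> = (\<Sum>e\<in>arcs G. incidence e p * (\<Sum>s\<in>UNIV - {p}. incidence e s) / len e)"
    by (simp add: sum_distrib_left sum_divide_distrib)
  also have "\<dots> = - (\<Sum>e\<in>arcs G. incidence e p * incidence e p / len e)"
    using sum_incidence[of _ "\<lambda>_. 1"] by (simp add: sum_diff1 sum_negf)
  finally show ?thesis using True by (simp add: discrete_laplacian_def)
qed (simp add: discrete_laplacian_def laplacian_entry_eq)

lemma laplacian_arc: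
  assumes e: "e \<in> arcs G"
  shows "lap $ t e $ h e = - 1 / len e"
proof -
  have *: "joins G e (t e) (h e)" using e by (simp add: joins_def)
  then have "(THE e'. joins G e' (t e) (h e)) = e" using joins_unique by blast
  then show ?thesis using loopfree[OF e] * by (auto simp: discrete_laplacian_def laplacian_entry_def)
qed

lemma laplacian_mult:
  "(\<Sum>q\<in>UNIV. lap $ p $ q * f q) = (\<Sum>e\<in>arcs G. incidence e p * (f (h e) - f (t e)) / len e)"
proof -
  have "(\<Sum>q\<in>UNIV. lap $ p $ q * f q) = (\<Sum>e\<in>arcs G. \<Sum>q\<in>UNIV. incidence e p * incidence e q / len e * f q)"
    by (simp add: laplacian_eq sum_distrib_right) (rule sum.swap)
  also have "\<dots> = (\<Sum>e\<in>arcs G. incidence e p / len e * (\<Sum>q\<in>UNIV. incidence e q * f q))"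
    by (simp add: sum_distrib_left mult.assoc)
  finally show ?thesis by (simp add: sum_incidence)
qed

text \<open>Summation over the vertices turns each incidence row into a difference along its arc;
  the result is the Dirichlet form of the circuit. Taking \<open>g\<close> constant shows that the
  columns of the Laplacian sum to 0.\<close>

lemma laplacian_form:
  "(\<Sum>p\<in>UNIV. \<Sum>q\<in>UNIV. lap $ p $ q * g p * f q) = (\<Sum>e\<in>arcs G. (g (h e) - g (t e)) * (f (h e) - f (t e)) / len e)"
proof -
  have "(\<Sum>p\<in>UNIV. \<Sum>q\<in>UNIV. lap $ p $ q * g p * f q) = (\<Sum>p\<in>UNIV. g p * (\<Sum>q\<in>UNIV. lap $ p $ q * f q))"
    by (simp add: sum_distrib_left mult.assoc mult.left_commute)
  also have "\<dots> = (\<Sum>e\<in>arcs G. (\<Sum>p\<in>UNIV. incidence e p * g p) * ((f (h e) - f (t e)) / len e))"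
    unfolding laplacian_mult sum_distrib_left sum_distrib_right
    by (subst sum.swap) (simp add: mult_ac)
  finally show ?thesis by (simp add: sum_incidence)
qed

text \<open>The energy of \<open>f\<close> is 0 and a sum of nonnegative terms, so \<open>f\<close>
  does not change along any arc.\<close>

lemma laplacian_kernel:
  assumes "\<And>p. (\<Sum>q\<in>UNIV. lap $ p $ q * f q) = 0"
  shows "f p = f q"
proof (rule connected_imp_constant[of G _ _ f])
  show "Digraph_Component.connected G" using metrized by (simp add: metrized_graph_def)
  fix e assume e: "e \<in> arcs G"
  have "(\<Sum>p\<in>UNIV. \<Sum>q\<in>UNIV. lap $ p $ q * f p * f q) = (\<Sum>p\<in>UNIV. f p * (\<Sum>q\<in>UNIV. lap $ p $ q * f q))"
    by (simp add: sum_distrib_left mult_ac)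
  then have "(\<Sum>e\<in>arcs G. (f (h e) - f (t e)) * (f (h e) - f (t e)) / len e) = 0"
    using assms laplacian_form[of f f] by simp
  moreover have "0 \<le> (f (h e) - f (t e)) * (f (h e) - f (t e)) / len e" if "e \<in> arcs G" for e
    using len_pos[OF that] by (intro divide_nonneg_pos) auto
  ultimately have "(f (h e) - f (t e)) * (f (h e) - f (t e)) / len e = 0"
    using e by (subst (asm) sum_nonneg_eq_0_iff) auto
  then show "f (t e) = f (h e)" using e by simp
qed (simp_all add: verts_UNIV)

lemma laplacian_sym: "lap $ p $ q = lap $ q $ p"
  by (simp add: laplacian_eq mult.commute)

lemma laplacian_pinv:
  shows "lap ** pinv = mat 1 - (\<chi> i j. 1 / real CARD('v))"
    and "transpose pinv = pinv"
    and "(\<chi> i j. 1 / real CARD('v)) ** pinv = (0 :: real ^ 'v ^ 'v)"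
proof -
  have "transpose lap = lap" by (simp add: vec_eq_iff transpose_def laplacian_sym)
  moreover have "lap *v (\<chi> i. 1) = 0"
    using laplacian_mult[of _ "\<lambda>_. 1"] by (simp add: vec_eq_iff matrix_vector_mult_def)
  moreover have "x $ i = x $ j" if "lap *v x = 0" for x i j
    using that laplacian_kernel[of "($) x"] by (simp add: vec_eq_iff matrix_vector_mult_def)
  ultimately have "lap ** pinv = mat 1 - (\<chi> i j. 1 / real CARD('v))
      \<and> transpose pinv = pinv \<and> (\<chi> i j. 1 / real CARD('v)) ** pinv = (0 :: real ^ 'v ^ 'v)"
    by (intro conjI pseudo_inverse_of_constant_kernel) auto
  then show "lap ** pinv = mat 1 - (\<chi> i j. 1 / real CARD('v))" "transpose pinv = pinv" "(\<chi> i j. 1 / real CARD('v)) ** pinv = (0 :: real ^ 'v ^ 'v)"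
    by auto
qed

lemma pinv_sym: "pinv $ p $ q = pinv $ q $ p"
  using arg_cong[OF laplacian_pinv(2), of "\<lambda>X. X $ q $ p"] by (simp add: transpose_def)

lemma laplacian_mult_pinv: "(\<Sum>q\<in>UNIV. lap $ p $ q * pinv $ q $ s) = of_bool (p = s) - 1 / real CARD('v)"
  using laplacian_pinv(1) by (simp add: vec_eq_iff matrix_matrix_mult_def mat_def)

lemma pinv_row_sum: "(\<Sum>q\<in>UNIV. pinv $ p $ q) = 0"
  using laplacian_pinv(3) by (simp add: vec_eq_iff matrix_matrix_mult_def pinv_sym[of p] flip: sum_divide_distrib)

section \<open>The Green function of a metrized graph\<close>

abbreviation pt :: "'e \<Rightarrow> real \<Rightarrow> ('v, 'e) mg_point" where "pt \<equiv> edge_point G len"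
abbreviation \<Gamma> :: "('v, 'e) mg_point set" where "\<Gamma> \<equiv> mg_points G len"
abbreviation M :: "('v, 'e) mg_point measure" where "M \<equiv> mg_borel G len"

lemma Vertex_in_points [simp]: "Vertex p \<in> \<Gamma>"
  by (simp add: mg_points_def verts_UNIV)

lemma Inner_in_points [simp]: "Inner e s \<in> \<Gamma> \<longleftrightarrow> e \<in> arcs G \<and> 0 < s \<and> s < len e"
  by (auto simp: mg_points_def)

lemma edge_point_in_points [simp]: "e \<in> arcs G \<Longrightarrow> pt e s \<in> \<Gamma>"
  by (simp add: edge_point_def)

lemma edge_point_0 [simp]: "pt e 0 = Vertex (t e)"
  by (simp add: edge_point_def)

lemma edge_point_len [simp]: "e \<in> arcs G \<Longrightarrow> pt e (len e) = Vertex (h e)"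
  using len_pos[of e] by (auto simp: edge_point_def simp del: len_pos)

lemma edge_point_inner [simp]: "0 < s \<Longrightarrow> s < len e \<Longrightarrow> pt e s = Inner e s"
  by (simp add: edge_point_def)

section \<open>Measurability and boundedness through the edge parametrizations\<close>

lemma space_mg_borel [simp]: "space M = \<Gamma>"
  by (simp add: mg_borel_def space_measure_of_conv)

lemma openin_in_sets_mg_borel: "openin (mg_topology G len) U \<Longrightarrow> U \<in> sets M"
  unfolding mg_borel_def by (subst sets_measure_of) (auto simp: openin_mg_topology)

lemma measurable_edge_point:
  assumes e: "e \<in> arcs G"
  shows "pt e \<in> measurable (restrict_space lborel {0..len e}) M"
  unfolding mg_borel_def
proof (rule measurable_measure_of)
  fix U assume "U \<in> {U. openin (mg_topology G len) U}"
  then have "openin (top_of_set {0..len e}) {s\<in>{0..len e}. pt e s \<in> U}"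
    using e by (auto simp: openin_mg_topology)
  then obtain T where T: "open T" "{s\<in>{0..len e}. pt e s \<in> U} = {0..len e} \<inter> T"
    by (auto simp: openin_open)
  have "pt e -` U \<inter> space (restrict_space lborel {0..len e}) = {s\<in>{0..len e}. pt e s \<in> U}"
    by (auto simp: space_restrict_space)
  then show "pt e -` U \<inter> space (restrict_space lborel {0..len e}) \<in> sets (restrict_space lborel {0..len e})"
    using T by (auto simp: sets_restrict_space)
qed (use e in \<open>auto simp: openin_mg_topology\<close>)

text \<open>A subset of \<open>\<Gamma>\<close> is open in the gluing topology when its preimages in
  all closed segments are relatively open, so continuity on every segment is continuity on the
  graph.\<close>

lemma borel_measurable_edgewise:
  fixes f :: "('v, 'e) mg_point \<Rightarrow> real"
  assumes f: "\<And>e. e \<in> arcs G \<Longrightarrow> continuous_on {0..len e} (\<lambda>s. f (pt e s))"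
  shows "f \<in> borel_measurable M"
proof (rule borel_measurableI)
  fix S :: "real set" assume S: "open S"
  have "openin (mg_topology G len) (f -` S \<inter> \<Gamma>)"
    unfolding openin_mg_topology
  proof (intro conjI ballI)
    fix e assume e: "e \<in> arcs G"
    have "{s\<in>{0..len e}. pt e s \<in> f -` S \<inter> \<Gamma>} = {0..len e} \<inter> (\<lambda>s. f (pt e s)) -` S"
      using e by auto
    then show "openin (top_of_set {0..len e}) {s\<in>{0..len e}. pt e s \<in> f -` S \<inter> \<Gamma>}"
      using continuous_openin_preimage_gen[OF f[OF e] S] by simp
  qed auto
  then show "f -` S \<inter> space M \<in> sets M"
    by (simp add: openin_in_sets_mg_borel)
qed

lemma bounded_edgewise:
  fixes f :: "('v, 'e) mg_point \<Rightarrow> real"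
  assumes f: "\<And>e. e \<in> arcs G \<Longrightarrow> continuous_on {0..len e} (\<lambda>s. f (pt e s))"
  obtains B where "\<And>x. x \<in> \<Gamma> \<Longrightarrow> \<bar>f x\<bar> \<le> B"
proof -
  have "bounded ((\<lambda>s. f (pt e s)) ` {0..len e})" if "e \<in> arcs G" for e
    by (intro compact_imp_bounded compact_continuous_image f that compact_Icc)
  then have "bounded (\<Union>e\<in>arcs G. (\<lambda>s. f (pt e s)) ` {0..len e})"
    by (intro bounded_UN finite_arcs ballI)
  \<comment> \<open>The vertices are added separately, since a graph with a single vertex may have
    no edges.\<close>
  then have "bounded ((\<Union>e\<in>arcs G. (\<lambda>s. f (pt e s)) ` {0..len e}) \<union> range (\<lambda>p. f (Vertex p)))"
    by (simp add: finite_imp_bounded)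
  moreover have "f x \<in> (\<Union>e\<in>arcs G. (\<lambda>s. f (pt e s)) ` {0..len e}) \<union> range (\<lambda>p. f (Vertex p))"
    if "x \<in> \<Gamma>" for x
  proof (cases x)
    case (Inner e s)
    then have "f x = f (pt e s)" "e \<in> arcs G" "s \<in> {0..len e}" using that by auto
    then show ?thesis by blast
  qed simp
  then have "f ` \<Gamma> \<subseteq> (\<Union>e\<in>arcs G. (\<lambda>s. f (pt e s)) ` {0..len e}) \<union> range (\<lambda>p. f (Vertex p))"
    by blast
  ultimately have "bounded (f ` \<Gamma>)" by (rule bounded_subset)
  then show ?thesis using that by (auto simp: bounded_real)
qed

section \<open>Barycentric coordinates, bridges and their combination\<close>

definition hat :: "('v, 'e) mg_point \<Rightarrow> 'v \<Rightarrow> real" where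
  "hat x p = (case x of Vertex q \<Rightarrow> of_bool (p = q)
     | Inner e s \<Rightarrow> (1 - s / len e) * of_bool (p = t e) + s / len e * of_bool (p = h e))"

text \<open>The value at vertices is irrelevant: \<open>bridge\<close> below vanishes for both values \<open>0\<close> and \<open>len e\<close>.\<close>

definition pos :: "'e \<Rightarrow> ('v, 'e) mg_point \<Rightarrow> real" where
  "pos e x = (case x of Vertex q \<Rightarrow> 0 | Inner e' s \<Rightarrow> if e' = e then s else 0)"

definition bridge :: "'e \<Rightarrow> real \<Rightarrow> real \<Rightarrow> real" where
  "bridge e r s = min r s - r * s / len e"

text \<open>These are the values of \<open>green _ y\<close> at the vertices, by
  \<open>green_Vertex\<close>: a charge at \<open>y\<close> acts on them as if distributed over the
  ends of its edge with weights \<open>hat y\<close>.\<close>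

definition potential :: "('v, 'e) mg_point \<Rightarrow> 'v \<Rightarrow> real" where
  "potential y p = (\<Sum>q\<in>UNIV. pinv $ p $ q * hat y q)"

definition green :: "('v, 'e) mg_point \<Rightarrow> ('v, 'e) mg_point \<Rightarrow> real" where
  "green x y = (\<Sum>p\<in>UNIV. hat x p * potential y p) + (\<Sum>e\<in>arcs G. bridge e (pos e x) (pos e y))"

text \<open>The effective resistance between \<open>x\<close> and \<open>y\<close>;
  \<open>voltage_diag\<close> identifies it with the diagonal of the voltage function.\<close>

definition resistance :: "('v, 'e) mg_point \<Rightarrow> ('v, 'e) mg_point \<Rightarrow> real" where
  "resistance x y = green x x - 2 * green x y + green y y"

lemma hat_Vertex [simp]: "hat (Vertex q) p = of_bool (p = q)"
  by (simp add: hat_def)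

lemma pos_Vertex [simp]: "pos e (Vertex q) = 0"
  by (simp add: pos_def)

lemma pos_Inner [simp]: "pos e (Inner e' s) = (if e' = e then s else 0)"
  by (simp add: pos_def)

lemma bridge_0 [simp]: "0 \<le> s \<Longrightarrow> bridge e 0 s = 0" "0 \<le> s \<Longrightarrow> bridge e s 0 = 0"
  by (simp_all add: bridge_def)

lemma bridge_len [simp]:
  "e \<in> arcs G \<Longrightarrow> s \<le> len e \<Longrightarrow> bridge e (len e) s = 0"
  "e \<in> arcs G \<Longrightarrow> s \<le> len e \<Longrightarrow> bridge e s (len e) = 0"
  by (simp_all add: bridge_def)

lemma pos_nonneg: "x \<in> \<Gamma> \<Longrightarrow> 0 \<le> pos e x"
  by (cases x) auto

lemma pos_less_len: "e \<in> arcs G \<Longrightarrow> x \<in> \<Gamma> \<Longrightarrow> pos e x < len e"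
  by (cases x) auto

lemma hat_edge:
  assumes "e \<in> arcs G" "0 \<le> s" "s \<le> len e"
  shows "hat (pt e s) p = (1 - s / len e) * of_bool (p = t e) + s / len e * of_bool (p = h e)"
proof -
  consider "s = 0" | "s = len e" | "0 < s" "s < len e" using assms by linarith
  then show ?thesis using assms by cases (auto simp: hat_def)
qed

lemma sum_hat_edge:
  assumes "e \<in> arcs G" "0 \<le> s" "s \<le> len e"
  shows "(\<Sum>p\<in>UNIV. hat (pt e s) p * f p) = (1 - s / len e) * f (t e) + s / len e * f (h e)"
proof -
  have "(\<Sum>p\<in>UNIV. hat (pt e s) p * f p) =
      (\<Sum>p\<in>UNIV. (1 - s / len e) * (of_bool (p = t e) * f p) + s / len e * (of_bool (p = h e) * f p))"
    by (simp add: hat_edge[OF assms] algebra_simps)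
  then show ?thesis
    unfolding sum.distrib sum_distrib_left[symmetric] by simp
qed

lemma sum_hat:
  assumes "x \<in> \<Gamma>" shows "(\<Sum>p\<in>UNIV. hat x p) = 1"
proof (cases x)
  case (Inner e s)
  then show ?thesis using sum_hat_edge[of e s "\<lambda>_. 1"] assms by simp
qed simp

text \<open>\<open>pos\<close> is 0 at both ends of an edge although the parameter of the head is
  \<open>len e\<close>; the formula survives because \<open>bridge\<close> vanishes for either
  value.\<close>

lemma bridge_edge:
  assumes "e \<in> arcs G" "0 \<le> s" "s \<le> len e" "y \<in> \<Gamma>" "e' \<in> arcs G"
  shows "bridge e' (pos e' (pt e s)) (pos e' y) = (if e' = e then bridge e s (pos e y) else 0)"
proof -
  consider "s = 0" | "s = len e" | "0 < s" "s < len e" using assms by linarith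
  then show ?thesis
    using assms pos_nonneg[OF assms(4)] pos_less_len[OF _ assms(4)] by cases (auto simp: less_imp_le)
qed

lemma green_edge:
  assumes "e \<in> arcs G" "0 \<le> s" "s \<le> len e" "y \<in> \<Gamma>"
  shows "green (pt e s) y =
    (1 - s / len e) * potential y (t e) + s / len e * potential y (h e) + bridge e s (pos e y)"
  unfolding green_def sum_hat_edge[OF assms(1-3)]
  using assms by (simp add: bridge_edge cong: sum.cong)

lemma green_Vertex: "y \<in> \<Gamma> \<Longrightarrow> green (Vertex p) y = potential y p"
  by (simp add: green_def pos_nonneg)

lemma potential_Vertex [simp]: "potential (Vertex q) p = pinv $ p $ q"
  by (simp add: potential_def)

lemma green_sym: "green x y = green y x"
proof -
  have "(\<Sum>p\<in>UNIV. hat x p * potential y p) = (\<Sum>p\<in>UNIV. \<Sum>q\<in>UNIV. pinv $ p $ q * (hat x p * hat y q))"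
    by (simp add: potential_def sum_distrib_left mult_ac)
  also have "\<dots> = (\<Sum>q\<in>UNIV. \<Sum>p\<in>UNIV. pinv $ q $ p * (hat x p * hat y q))"
    by (subst sum.swap) (simp add: pinv_sym)
  also have "\<dots> = (\<Sum>p\<in>UNIV. hat y p * potential x p)"
    by (simp add: potential_def sum_distrib_left mult_ac)
  finally show ?thesis
    by (simp add: green_def bridge_def min.commute mult.commute)
qed

lemma resistance_sym: "resistance x y = resistance y x"
  by (simp add: resistance_def green_sym[of y x])

lemma potential_edge:
  assumes "e \<in> arcs G" "0 \<le> s" "s \<le> len e"
  shows "potential (pt e s) p = (1 - s / len e) * pinv $ p $ t e + s / len e * pinv $ p $ h e"
  using sum_hat_edge[OF assms, of "\<lambda>q. pinv $ p $ q"] by (simp add: potential_def mult.commute)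

text \<open>The effective resistance between the ends of \<open>e\<close>.\<close>

definition edge_resistance :: "'e \<Rightarrow> real" where
  "edge_resistance e = pinv $ t e $ t e - 2 * pinv $ t e $ h e + pinv $ h e $ h e"

text \<open>With \<open>u = s / len e\<close>, the quadratic form of \<open>pinv\<close> at
  \<open>hat\<close> is the affine interpolation of its diagonal entries minus
  \<open>u * (1 - u) * edge_resistance e\<close>, and the bridge contributes
  \<open>u * (1 - u) * len e\<close>.\<close>

lemma green_diag_edge:
  assumes e: "e \<in> arcs G" "0 \<le> s" "s \<le> len e"
  shows "green (pt e s) (pt e s) = (1 - s / len e) * pinv $ t e $ t e + s / len e * pinv $ h e $ h e
    + (s / len e * (1 - s / len e)) * (len e - edge_resistance e)"
proof -
  have "bridge e s (pos e (pt e s)) = s - s * s / len e"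
  proof -
    consider "s = 0" | "s = len e" | "0 < s" "s < len e" using assms by linarith
    then show ?thesis using assms by cases (auto simp: bridge_def)
  qed
  then have "green (pt e s) (pt e s) = (1 - s / len e) * potential (pt e s) (t e) + s / len e * potential (pt e s) (h e) + (s - s * s / len e)"
    using green_edge[OF e, of "pt e s"] e by simp
  also have "\<dots> = (1 - s / len e) * pinv $ t e $ t e + s / len e * pinv $ h e $ h e
    + (s / len e * (1 - s / len e)) * (len e - edge_resistance e)"
    unfolding potential_edge[OF e] pinv_sym[of "h e" "t e"] edge_resistance_def
    using e by (simp add: field_simps)
  finally show ?thesis .
qed

section \<open>Continuity, measurability and boundedness of the kernel\<close>

lemma continuous_on_hat: "e \<in> arcs G \<Longrightarrow> continuous_on {0..len e} (\<lambda>s. hat (pt e s) p)"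
  by (subst continuous_on_cong[OF refl hat_edge]) (auto intro!: continuous_intros)

lemma continuous_on_resistance:
  assumes "e \<in> arcs G" "x \<in> \<Gamma>"
  shows "continuous_on {0..len e} (\<lambda>s. resistance x (pt e s))"
proof -
  have "continuous_on {0..len e} (\<lambda>s. green (pt e s) x)"
    using assms by (subst continuous_on_cong[OF refl green_edge]) (auto simp: bridge_def intro!: continuous_intros)
  moreover have "continuous_on {0..len e} (\<lambda>s. green (pt e s) (pt e s))"
    using assms by (subst continuous_on_cong[OF refl green_diag_edge]) (auto intro!: continuous_intros)
  ultimately show ?thesis
    by (subst resistance_sym) (simp add: resistance_def continuous_intros)
qed

lemma measurable_hat [measurable]: "(\<lambda>x. hat x p) \<in> borel_measurable M"
  by (intro borel_measurable_edgewise continuous_on_hat)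

text \<open>\<open>pos e\<close> jumps from \<open>len e\<close> to 0 at the head of
  \<open>e\<close>, so measurability cannot come from continuity along edges. For nonnegative
  \<open>a\<close> the superlevel set is nevertheless open, being a possibly empty open piece of
  \<open>e\<close>.\<close>

lemma measurable_pos [measurable]:
  assumes e: "e \<in> arcs G" shows "pos e \<in> borel_measurable M"
  unfolding borel_measurable_iff_greater space_mg_borel
proof
  fix a :: real
  show "{x \<in> \<Gamma>. a < pos e x} \<in> sets M"
  proof (cases "a < 0")
    case True
    then have "{x \<in> \<Gamma>. a < pos e x} = space M"
      using pos_nonneg[of _ e] by force
    then show ?thesis by (metis sets.top)
  next
    case False
    have "openin (mg_topology G len) {x \<in> \<Gamma>. a < pos e x}"
      unfolding openin_mg_topology
    proof (intro conjI ballI)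
      fix e' assume e': "e' \<in> arcs G"
      have "{s \<in> {0..len e'}. pt e' s \<in> {x \<in> \<Gamma>. a < pos e x}} =
          (if e' = e then {0..len e} \<inter> {a<..<len e} else {})"
      proof -
        have *: "(pt e' s \<in> {x \<in> \<Gamma>. a < pos e x}) = (e' = e \<and> a < s \<and> s < len e)" if "s \<in> {0..len e'}" for s
        proof -
          consider "s = 0" | "s = len e'" | "0 < s" "s < len e'" using \<open>s \<in> {0..len e'}\<close> by force
          then show ?thesis using e' False by cases auto
        qed
        have "{s \<in> {0..len e'}. pt e' s \<in> {x \<in> \<Gamma>. a < pos e x}} =
            {s \<in> {0..len e'}. e' = e \<and> a < s \<and> s < len e}"
          by (rule Collect_cong) (use * in blast)
        also have "\<dots> = (if e' = e then {0..len e} \<inter> {a<..<len e} else {})"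
          by (cases "e' = e") auto
        finally show ?thesis .
      qed
      then show "openin (top_of_set {0..len e'}) {s \<in> {0..len e'}. pt e' s \<in> {x \<in> \<Gamma>. a < pos e x}}"
        by (auto simp: openin_open_Int)
    qed auto
    then show ?thesis by (rule openin_in_sets_mg_borel)
  qed
qed

text \<open>\<open>green\<close> is built by finite sums, products and minima from functions of a
  single variable, so the joint measurability that Fubini asks for reduces to that of
  \<open>hat\<close> and \<open>pos\<close>.\<close>

lemma measurable_green: "case_prod green \<in> borel_measurable (M \<Otimes>\<^sub>M M)"
proof -
  have [measurable]: "(\<lambda>x. pos e (fst x)) \<in> borel_measurable (M \<Otimes>\<^sub>M M)"
    "(\<lambda>x. pos e (snd x)) \<in> borel_measurable (M \<Otimes>\<^sub>M M)" if "e \<in> arcs G" for e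
    using measurable_pos[OF that] by measurable
  show ?thesis
    unfolding case_prod_beta green_def bridge_def potential_def
    by (intro borel_measurable_add borel_measurable_sum) measurable
qed

lemma measurable_resistance: "case_prod resistance \<in> borel_measurable (M \<Otimes>\<^sub>M M)"
proof -
  have g: "(\<lambda>x. green (f x) (g x)) \<in> borel_measurable N"
    if "f \<in> measurable N M" "g \<in> measurable N M" for f g and N :: "'c measure"
    using measurable_compose[OF measurable_Pair[OF that] measurable_green] by simp
  show ?thesis
    unfolding case_prod_beta resistance_def
    by (intro borel_measurable_add borel_measurable_diff borel_measurable_times borel_measurable_const g) measurable
qed

lemma hat_bounded:
  assumes "x \<in> \<Gamma>" shows "\<bar>hat x p\<bar> \<le> 1"
proof (cases x)
  case (Inner e s)
  then show ?thesis using assms loopfree[of e] by (auto simp: hat_def of_bool_def divide_simps)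
qed simp

lemma resistance_bounded:
  obtains B where "\<And>x y. x \<in> \<Gamma> \<Longrightarrow> y \<in> \<Gamma> \<Longrightarrow> \<bar>resistance x y\<bar> \<le> B"
proof -
  define C where "C = (\<Sum>p\<in>UNIV. \<Sum>q\<in>UNIV. \<bar>pinv $ p $ q\<bar>) + (\<Sum>e\<in>arcs G. 2 * len e)"
  have green: "\<bar>green x y\<bar> \<le> C" if xy: "x \<in> \<Gamma>" "y \<in> \<Gamma>" for x y
  proof -
    have "\<bar>\<Sum>p\<in>UNIV. hat x p * potential y p\<bar> \<le> (\<Sum>p\<in>UNIV. \<Sum>q\<in>UNIV. \<bar>pinv $ p $ q\<bar>)"
    proof (rule order_trans[OF sum_abs], rule sum_mono)
      fix p
      have "\<bar>potential y p\<bar> \<le> (\<Sum>q\<in>UNIV. \<bar>pinv $ p $ q\<bar>)"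
        unfolding potential_def
        by (rule order_trans[OF sum_abs], rule sum_mono)
           (simp add: abs_mult mult_left_le hat_bounded[OF xy(2)])
      then have "\<bar>hat x p\<bar> * \<bar>potential y p\<bar> \<le> 1 * (\<Sum>q\<in>UNIV. \<bar>pinv $ p $ q\<bar>)"
        by (intro mult_mono hat_bounded xy) auto
      then show "\<bar>hat x p * potential y p\<bar> \<le> (\<Sum>q\<in>UNIV. \<bar>pinv $ p $ q\<bar>)"
        by (simp add: abs_mult)
    qed
    moreover have "\<bar>\<Sum>e\<in>arcs G. bridge e (pos e x) (pos e y)\<bar> \<le> (\<Sum>e\<in>arcs G. 2 * len e)"
    proof (rule order_trans[OF sum_abs], rule sum_mono)
      fix e assume e: "e \<in> arcs G"
      note b = pos_nonneg[OF xy(1), of e] pos_nonneg[OF xy(2), of e]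
        pos_less_len[OF e xy(1)] pos_less_len[OF e xy(2)]
      have "pos e x * pos e y \<le> len e * len e" using b by (intro mult_mono) auto
      then have "pos e x * pos e y / len e \<le> len e" using e by (simp add: divide_le_eq)
      moreover have "0 \<le> pos e x * pos e y / len e" using b e by simp
      ultimately show "\<bar>bridge e (pos e x) (pos e y)\<bar> \<le> 2 * len e"
        using b unfolding bridge_def by linarith
    qed
    ultimately show ?thesis
      unfolding green_def C_def using abs_triangle_ineq order_trans by fastforce
  qed
  show ?thesis
  proof (rule that)
    fix x y assume "x \<in> \<Gamma>" "y \<in> \<Gamma>"
    then show "\<bar>resistance x y\<bar> \<le> 4 * C"
      using green[of x x] green[of x y] green[of y y] by (simp add: resistance_def abs_le_iff)
  qed
qed

end

section \<open>Voltage functions\<close>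

text \<open>\<open>has_slope\<close> controls only a one-sided neighbourhood of unspecified size. In
  the interior the two one-sided slopes fit together, so the slope is a locally constant function of
  the point and hence constant; comparison near 0 and \<open>l\<close> then includes the
  ends.\<close>

lemma locally_affine_imp_affine:
  fixes \<phi> :: "real \<Rightarrow> real"
  assumes l: "0 < l"
    and inner: "\<And>s. 0 < s \<Longrightarrow> s < l \<Longrightarrow> \<exists>a. (\<forall>\<^sub>F x in at_right 0. \<phi> (s + x) = \<phi> s + a * x) \<and>
                  (\<forall>\<^sub>F x in at_right 0. \<phi> (s - x) = \<phi> s - a * x)"
    and left: "\<forall>\<^sub>F x in at_right 0. \<phi> x = \<phi> 0 + a0 * x"
    and right: "\<forall>\<^sub>F x in at_right 0. \<phi> (l - x) = \<phi> l + a1 * x"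
  shows "a1 = - a0" and "\<And>s. 0 \<le> s \<Longrightarrow> s \<le> l \<Longrightarrow> \<phi> s = \<phi> 0 + a0 * s"
proof -
  have "\<exists>a. \<exists>\<delta>>0. \<forall>y. \<bar>y - s\<bar> < \<delta> \<longrightarrow> \<phi> y = \<phi> s + a * (y - s)" if s: "0 < s" "s < l" for s
  proof -
    obtain a where a: "\<forall>\<^sub>F x in at_right 0. \<phi> (s + x) = \<phi> s + a * x" "\<forall>\<^sub>F x in at_right 0. \<phi> (s - x) = \<phi> s - a * x"
      using inner[OF s] by blast
    then obtain b where b: "0 < b" "\<And>x. 0 < x \<Longrightarrow> x < b \<Longrightarrow> \<phi> (s + x) = \<phi> s + a * x"
      by (auto simp: eventually_at_right_field)
    obtain c where c: "0 < c" "\<And>x. 0 < x \<Longrightarrow> x < c \<Longrightarrow> \<phi> (s - x) = \<phi> s - a * x"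
      using a(2) by (auto simp: eventually_at_right_field)
    have "\<phi> y = \<phi> s + a * (y - s)" if "\<bar>y - s\<bar> < min b c" for y
    proof -
      consider "y = s" | "y > s" | "y < s" by linarith
      then show ?thesis
      proof cases
        case 2 then show ?thesis using b(2)[of "y - s"] that by simp
      next
        case 3 then show ?thesis using c(2)[of "s - y"] that by (simp add: algebra_simps)
      qed simp
    qed
    then have "\<forall>y. \<bar>y - s\<bar> < min b c \<longrightarrow> \<phi> y = \<phi> s + a * (y - s)" by blast
    moreover have "0 < min b c" using b(1) c(1) by simp
    ultimately show ?thesis by blast
  qed
  then obtain a where a: "\<And>s. 0 < s \<Longrightarrow> s < l \<Longrightarrow> \<exists>\<delta>>0. \<forall>y. \<bar>y - s\<bar> < \<delta> \<longrightarrow> \<phi> y = \<phi> s + a s * (y - s)"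
    by metis
  have affine_deriv: "(\<phi> has_real_derivative c) (at y)"
    if eq: "\<And>z. \<bar>z - s\<bar> < \<delta> \<Longrightarrow> \<phi> z = \<phi> s + c * (z - s)" and y: "\<bar>y - s\<bar> < \<delta>" for s \<delta> c y
  proof (rule has_field_derivative_transform_within_open[where S = "ball s \<delta>" and f = "\<lambda>z. \<phi> s + c * (z - s)"])
    show "((\<lambda>z. \<phi> s + c * (z - s)) has_real_derivative c) (at y)"
      by (auto intro!: derivative_eq_intros)
    show "y \<in> ball s \<delta>" using y by (simp add: dist_real_def abs_minus_commute)
    show "\<phi> s + c * (z - s) = \<phi> z" if "z \<in> ball s \<delta>" for z
      by (rule eq[symmetric]) (use that in \<open>simp add: dist_real_def abs_minus_commute\<close>)
  qed simp
  have D: "(\<phi> has_real_derivative a s) (at s)" if s: "0 < s" "s < l" for s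
  proof -
    obtain \<delta> where \<delta>: "\<delta> > 0" "\<And>y. \<bar>y - s\<bar> < \<delta> \<Longrightarrow> \<phi> y = \<phi> s + a s * (y - s)"
      using a[OF s] by blast
    show ?thesis by (rule affine_deriv[OF \<delta>(2)]) (use \<delta>(1) in auto)
  qed
  \<comment> \<open>Near \<open>s\<close> the slope at \<open>y\<close> agrees with that at
    \<open>s\<close> by uniqueness of the derivative of \<open>\<phi>\<close>; this local constancy
    is expressed as a zero derivative of \<open>a\<close>.\<close>
  have "(a has_real_derivative 0) (at s)" if s: "0 < s" "s < l" for s
  proof -
    obtain \<delta> where \<delta>: "\<delta> > 0" "\<And>y. \<bar>y - s\<bar> < \<delta> \<Longrightarrow> \<phi> y = \<phi> s + a s * (y - s)"
      using a[OF s] by blast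
    define S where "S = ball s \<delta> \<inter> {0<..<l}"
    have a_eq: "a y = a s" if "y \<in> S" for y
    proof (rule DERIV_unique)
      show "(\<phi> has_real_derivative a y) (at y)" using that by (intro D) (auto simp: S_def)
      show "(\<phi> has_real_derivative a s) (at y)"
        by (rule affine_deriv[OF \<delta>(2)]) (use that in \<open>auto simp: S_def dist_real_def abs_minus_commute\<close>)
    qed
    show ?thesis
    proof (rule has_field_derivative_transform_within_open)
      show "((\<lambda>_. a s) has_real_derivative 0) (at s)" by simp
      show "open S" by (simp add: S_def open_Int)
      show "s \<in> S" using s \<delta>(1) by (simp add: S_def)
      show "a s = a y" if "y \<in> S" for y using a_eq[OF that] by (rule sym)
    qed
  qed
  then have "\<exists>c. \<forall>s\<in>{0<..<l}. a s = c"
    by (intro has_field_derivative_zero_constant convex_real_interval) (auto intro: has_field_derivative_at_within)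
  then obtain c where c: "\<And>s. 0 < s \<Longrightarrow> s < l \<Longrightarrow> a s = c" by auto
  have "((\<lambda>s. \<phi> s - c * s) has_real_derivative 0) (at s)" if "0 < s" "s < l" for s
    using D[OF that] c[OF that] by (auto intro!: derivative_eq_intros)
  then have "\<exists>k. \<forall>s\<in>{0<..<l}. \<phi> s - c * s = k"
    by (intro has_field_derivative_zero_constant convex_real_interval) (auto intro: has_field_derivative_at_within)
  then obtain k where k: "\<And>s. 0 < s \<Longrightarrow> s < l \<Longrightarrow> \<phi> s = k + c * s" by (auto simp: algebra_simps)
  \<comment> \<open>Affine expressions that agree just to the right of 0 coincide; this matches both
    the value and the slope at an end with those of the interior formula.\<close>
  have two_points: "p = q \<and> m = n"
    if eq: "\<forall>\<^sub>F x in at_right 0. p + m * x = q + n * x" for p q m n :: real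
  proof -
    obtain b where b: "0 < b" "\<And>x. 0 < x \<Longrightarrow> x < b \<Longrightarrow> p + m * x = q + n * x"
      using eq by (auto simp: eventually_at_right_field)
    have "p + m * (b / 2) = q + n * (b / 2)" by (rule b(2)) (use b(1) in auto)
    moreover have "p + m * (b / 4) = q + n * (b / 4)" by (rule b(2)) (use b(1) in auto)
    ultimately have "p = q" "m * b = n * b" by linarith+
    then show ?thesis using b(1) by simp
  qed
  have ev: "\<forall>\<^sub>F x in at_right 0. x < l" "\<forall>\<^sub>F x in at_right (0::real). 0 < x"
    using l by (auto simp: eventually_at_right_field)
  have "\<forall>\<^sub>F x in at_right 0. \<phi> 0 + a0 * x = k + c * x"
    using left ev by eventually_elim (use k in auto)
  then have 0: "\<phi> 0 = k" "a0 = c" using two_points by blast+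
  have "\<forall>\<^sub>F x in at_right 0. \<phi> l + a1 * x = (k + c * l) + (- c) * x"
    using right ev by eventually_elim (use k in \<open>auto simp: algebra_simps\<close>)
  then have 1: "\<phi> l = k + c * l" "a1 = - c" using two_points by blast+
  show "a1 = - a0" using 0 1 by simp
  show "\<phi> s = \<phi> 0 + a0 * s" if "0 \<le> s" "s \<le> l" for s
    using that 0 1 k[of s] by (cases "s = 0"; cases "s = l") auto
qed

context optimal_metrized_graph begin

section \<open>Current balance of the Green function\<close>

lemma directions_Vertex:
  "directions G len (Vertex p) =
     (\<lambda>e. (e, 0, 1)) ` {e \<in> arcs G. t e = p} \<union> (\<lambda>e. (e, len e, - 1)) ` {e \<in> arcs G. h e = p}"
proof -
  have "pt e s = Vertex p \<longleftrightarrow> s = 0 \<and> t e = p \<or> s = len e \<and> h e = p" if e: "e \<in> arcs G" "0 \<le> s" "s \<le> len e" for e s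
  proof -
    consider "s = 0" | "s = len e" | "0 < s" "s < len e" using e(2,3) by linarith
    then show ?thesis using e len_pos[of e] by cases (auto simp del: len_pos)
  qed
  then show ?thesis using len_pos by (auto simp: directions_def image_iff less_imp_le)
qed

lemma directions_Inner:
  assumes "e \<in> arcs G" "0 < s" "s < len e"
  shows "directions G len (Inner e s) = {(e, s, 1), (e, s, - 1)}"
proof -
  have "pt e' s' = Inner e s \<longleftrightarrow> e' = e \<and> s' = s" if e': "e' \<in> arcs G" "0 \<le> s'" "s' \<le> len e'" for e' s'
  proof -
    consider "s' = 0" | "s' = len e'" | "0 < s'" "s' < len e'" using e'(2,3) by linarith
    then show ?thesis using e' assms by cases auto
  qed
  then show ?thesis using assms by (auto simp: directions_def)
qed

lemma sum_directions_Vertex: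
  "(\<Sum>d\<in>directions G len (Vertex p). m d) =
    (\<Sum>e\<in>arcs G. of_bool (p = t e) * m (e, 0, 1) + of_bool (p = h e) * m (e, len e, - 1) :: real)"
proof -
  have "(\<Sum>d\<in>directions G len (Vertex p). m d) =
      (\<Sum>d\<in>(\<lambda>e. (e, 0, 1)) ` {e \<in> arcs G. t e = p}. m d) + (\<Sum>d\<in>(\<lambda>e. (e, len e, - 1)) ` {e \<in> arcs G. h e = p}. m d)"
    unfolding directions_Vertex by (intro sum.union_disjoint) auto
  also have "\<dots> = (\<Sum>e\<in>{e \<in> arcs G. t e = p}. m (e, 0, 1)) + (\<Sum>e\<in>{e \<in> arcs G. h e = p}. m (e, len e, - 1))"
    by (subst (1 2) sum.reindex) (auto simp: inj_on_def)
  also have "\<dots> = (\<Sum>e\<in>arcs G. of_bool (p = t e) * m (e, 0, 1)) + (\<Sum>e\<in>arcs G. of_bool (p = h e) * m (e, len e, - 1))"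
    by (intro arg_cong2[where f = "(+)"] sum.mono_neutral_cong_left) auto
  finally show ?thesis by (simp add: sum.distrib)
qed

lemma sum_directions_Inner:
  assumes "e \<in> arcs G" "0 < s" "s < len e"
  shows "(\<Sum>d\<in>directions G len (Inner e s). m d) = (m (e, s, 1) + m (e, s, - 1) :: real)"
  by (simp add: directions_Inner[OF assms])

text \<open>\<open>lap ** pinv\<close> is the identity minus the projection onto the constants; it
  is applied to \<open>hat y\<close>, whose coordinates sum to 1.\<close>

lemma laplacian_mult_potential:
  assumes "y \<in> \<Gamma>"
  shows "(\<Sum>q\<in>UNIV. lap $ p $ q * potential y q) = hat y p - 1 / real CARD('v)"
proof -
  have "(\<Sum>q\<in>UNIV. lap $ p $ q * potential y q) = (\<Sum>s\<in>UNIV. (\<Sum>q\<in>UNIV. lap $ p $ q * pinv $ q $ s) * hat y s)"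
    by (simp add: potential_def sum_distrib_left sum_distrib_right mult.assoc) (rule sum.swap)
  also have "\<dots> = hat y p - (\<Sum>s\<in>UNIV. hat y s) / real CARD('v)"
    unfolding laplacian_mult_pinv by (simp add: left_diff_distrib sum_subtractf sum_divide_distrib)
  finally show ?thesis by (simp add: sum_hat[OF assms])
qed

text \<open>The \<open>of_bool\<close> terms are the slopes of \<open>min _ (pos e y)\<close>.\<close>

fun green_slope :: "('v, 'e) mg_point \<Rightarrow> 'e \<times> real \<times> real \<Rightarrow> real" where
  "green_slope y (e, s, \<sigma>) = \<sigma> * ((potential y (h e) - potential y (t e)) / len e - pos e y / len e)
     + (if \<sigma> = 1 then of_bool (s < pos e y) else - of_bool (s \<le> pos e y))"

text \<open>Along \<open>e\<close> the only kink of \<open>green _ y\<close> is that of the minimum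
  at \<open>pos e y\<close>; the step is taken so small that it neither crosses this point nor
  leaves the edge.\<close>

lemma has_slope_green:
  assumes y: "y \<in> \<Gamma>" and d: "d \<in> directions G len p"
  shows "has_slope G len (\<lambda>x. green x y) d (green_slope y d)"
proof -
  obtain e s \<sigma> where d': "d = (e, s, \<sigma>)" by (cases d)
  have e: "e \<in> arcs G" "0 \<le> s" "s \<le> len e" and \<sigma>: "\<sigma> = 1 \<and> s < len e \<or> \<sigma> = - 1 \<and> 0 < s"
    using d by (auto simp: d' directions_def)
  define c where "c = pos e y"
  have ev1: "\<forall>\<^sub>F x in at_right 0. x < b" if "0 < b" for b :: real
    using that by (auto simp: eventually_at_right_field)
  have "\<forall>\<^sub>F x in at_right 0. 0 \<le> s + \<sigma> * x \<and> s + \<sigma> * x \<le> len e \<and>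
      min (s + \<sigma> * x) c = min s c + (if \<sigma> = 1 then of_bool (s < c) else - of_bool (s \<le> c)) * x"
    using \<sigma>
  proof (elim disjE conjE)
    assume *: "\<sigma> = 1" "s < len e"
    have "\<forall>\<^sub>F x in at_right 0. 0 < x \<and> x < len e - s \<and> (s < c \<longrightarrow> x < c - s)"
      using ev1[of "len e - s"] ev1[of "c - s"] * eventually_at_right_less[of 0]
      by (cases "s < c") (auto simp: eventually_conj_iff)
    then show ?thesis
      by eventually_elim (use * e in auto)
  next
    assume *: "\<sigma> = - 1" "0 < s"
    have "\<forall>\<^sub>F x in at_right 0. 0 < x \<and> x < s \<and> (c < s \<longrightarrow> x < s - c)"
      using ev1[of s] ev1[of "s - c"] * eventually_at_right_less[of 0]
      by (cases "c < s") (auto simp: eventually_conj_iff)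
    then show ?thesis
      by eventually_elim (use * e in auto)
  qed
  then have "\<forall>\<^sub>F x in at_right 0. green (pt e (s + \<sigma> * x)) y = green (pt e s) y + green_slope y (e, s, \<sigma>) * x"
  proof eventually_elim
    case (elim x)
    define D :: real where "D = (if \<sigma> = 1 then of_bool (s < c) else - of_bool (s \<le> c))"
    define P Q where "P = potential y (t e)" and "Q = potential y (h e)"
    have "green (pt e (s + \<sigma> * x)) y =
        (1 - (s + \<sigma> * x) / len e) * P + (s + \<sigma> * x) / len e * Q + (min s c + D * x - (s + \<sigma> * x) * c / len e)"
      using elim by (simp add: green_edge[OF e(1) _ _ y] bridge_def c_def D_def P_def Q_def)
    also have "\<dots> = (1 - s / len e) * P + s / len e * Q + (min s c - s * c / len e)
        + (\<sigma> * ((Q - P) / len e - c / len e) + D) * x"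
      by (simp add: divide_inverse algebra_simps)
    also have "\<dots> = green (pt e s) y + green_slope y (e, s, \<sigma>) * x"
      by (simp add: green_edge[OF e y] bridge_def c_def D_def P_def Q_def)
    finally show ?case .
  qed
  then show ?thesis by (simp add: d')
qed

text \<open>\<open>green _ y\<close> is the potential of a unit charge at \<open>y\<close> together
  with a charge \<open>- 1 / v\<close> at each of the \<open>v\<close> vertices. The summand with
  \<open>pinv\<close> places the unit charge at vertices with weights \<open>hat y\<close>, and the
  bridge moves it to \<open>y\<close>. The compensating charges do not depend on
  \<open>y\<close>.\<close>

lemma sum_green_slope:
  assumes p: "p \<in> \<Gamma>" and y: "y \<in> \<Gamma>"
  shows "(\<Sum>d\<in>directions G len p. - green_slope y d) =
    of_bool (p = y) - (case p of Vertex _ \<Rightarrow> 1 / real CARD('v) | Inner _ _ \<Rightarrow> 0)"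
proof (cases p)
  case (Inner e s)
  then have *: "e \<in> arcs G" "0 < s" "s < len e" using p by auto
  show ?thesis using y *
    by (cases y) (auto simp: Inner sum_directions_Inner diff_divide_distrib)
next
  case (Vertex v)
  have "of_bool (v = t e) * (- green_slope y (e, 0, 1)) + of_bool (v = h e) * (- green_slope y (e, len e, - 1)) =
      incidence e v * (potential y (h e) - potential y (t e)) / len e
      + (of_bool (v = t e) * (pos e y / len e - of_bool (0 < pos e y)) - of_bool (v = h e) * (pos e y / len e))"
    if e: "e \<in> arcs G" for e
    using pos_less_len[OF e y] loopfree[OF e] by (auto simp: incidence_def diff_divide_distrib)
  then have "(\<Sum>d\<in>directions G len p. - green_slope y d) =
      (\<Sum>e\<in>arcs G. incidence e v * (potential y (h e) - potential y (t e)) / len e)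
      + (\<Sum>e\<in>arcs G. of_bool (v = t e) * (pos e y / len e - of_bool (0 < pos e y)) - of_bool (v = h e) * (pos e y / len e))"
    unfolding Vertex sum_directions_Vertex by (simp add: sum.distrib cong: sum.cong del: green_slope.simps)
  also have "(\<Sum>e\<in>arcs G. incidence e v * (potential y (h e) - potential y (t e)) / len e) = hat y v - 1 / real CARD('v)"
    using laplacian_mult_potential[OF y] laplacian_mult by metis
  \<comment> \<open>The bridge of the edge containing \<open>y\<close> removes exactly the charge
    \<open>hat y\<close> from its ends; if \<open>y\<close> is a vertex, all \<open>pos e y\<close>
    are 0 and both sides vanish.\<close>
  also have "(\<Sum>e\<in>arcs G. of_bool (v = t e) * (pos e y / len e - of_bool (0 < pos e y)) - of_bool (v = h e) * (pos e y / len e))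
      = of_bool (p = y) - hat y v"
  proof (cases y)
    case (Inner e s)
    then have *: "e \<in> arcs G" "0 < s" using y by auto
    have "(\<Sum>e\<in>arcs G. of_bool (v = t e) * (pos e y / len e - of_bool (0 < pos e y)) - of_bool (v = h e) * (pos e y / len e))
      = (\<Sum>e'\<in>arcs G. if e' = e then of_bool (v = t e) * (s / len e - 1) - of_bool (v = h e) * (s / len e) else 0)"
      using * by (intro sum.cong) (auto simp: Inner)
    then show ?thesis using * by (simp add: Inner Vertex hat_def algebra_simps)
  qed (simp add: Vertex)
  finally show ?thesis by (simp add: Vertex)
qed

section \<open>Existence and uniqueness of the voltage\<close>

lemma has_slope_diff:
  assumes "has_slope G len f d m" "has_slope G len g d n"
  shows "has_slope G len (\<lambda>x. f x - g x) d (m - n)"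
proof (cases d)
  case (fields e s \<sigma>)
  then have "\<forall>\<^sub>F x in at_right 0. f (pt e (s + \<sigma> * x)) = f (pt e s) + m * x"
    "\<forall>\<^sub>F x in at_right 0. g (pt e (s + \<sigma> * x)) = g (pt e s) + n * x"
    using assms by auto
  then have "\<forall>\<^sub>F x in at_right 0. f (pt e (s + \<sigma> * x)) - g (pt e (s + \<sigma> * x)) = f (pt e s) - g (pt e s) + (m - n) * x"
    by eventually_elim (simp add: algebra_simps)
  then show ?thesis by (simp add: fields)
qed

lemma has_slope_const: "has_slope G len (\<lambda>_. c) d 0"
  by (cases d) simp

lemma has_slope_cong:
  assumes "d \<in> directions G len p" "\<And>x. x \<in> \<Gamma> \<Longrightarrow> f x = g x"
  shows "has_slope G len f d m \<longleftrightarrow> has_slope G len g d m"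
  using assms by (cases d) (auto simp: directions_def)

text \<open>In the difference of two Green functions the charges spread over the vertices cancel,
  which leaves 1 at \<open>y\<close> and -1 at \<open>z\<close>; the subtracted constant sets the
  value at \<open>z\<close> to 0.\<close>

lemma is_voltage_green:
  assumes y: "y \<in> \<Gamma>" and z: "z \<in> \<Gamma>"
  shows "is_voltage G len z y (restrict (\<lambda>x. green x y - green x z - (green z y - green z z)) \<Gamma>)"
  unfolding is_voltage_def
proof (intro conjI exI ballI)
  fix p assume p: "p \<in> \<Gamma>"
  show "has_slope G len (restrict (\<lambda>x. green x y - green x z - (green z y - green z z)) \<Gamma>) d
      (green_slope y d - green_slope z d - 0)" if "d \<in> directions G len p" for d
    by (subst has_slope_cong[OF that restrict_apply'], assumption)
       (intro has_slope_diff has_slope_const has_slope_green[OF _ that] y z)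
  show "(\<Sum>d\<in>directions G len p. - (green_slope y d - green_slope z d - 0)) = of_bool (p = y) - of_bool (p = z)"
  proof -
    have "(\<Sum>d\<in>directions G len p. - (green_slope y d - green_slope z d - 0)) =
        (\<Sum>d\<in>directions G len p. - green_slope y d) - (\<Sum>d\<in>directions G len p. - green_slope z d)"
      by (simp flip: sum_subtractf)
    then show ?thesis unfolding sum_green_slope[OF p y] sum_green_slope[OF p z] by simp
  qed
qed (use z in auto)

text \<open>Without injected current \<open>f\<close> is affine on every edge, and its vertex values
  lie in the kernel of the Laplacian.\<close>

lemma harmonic_constant:
  assumes slope: "\<And>p d. p \<in> \<Gamma> \<Longrightarrow> d \<in> directions G len p \<Longrightarrow> has_slope G len f d (m d)"
    and sum0: "\<And>p. p \<in> \<Gamma> \<Longrightarrow> (\<Sum>d\<in>directions G len p. m d) = 0"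
    and xy: "x \<in> \<Gamma>" "y \<in> \<Gamma>"
  shows "f x = f y"
proof -
  have edge: "m (e, len e, - 1) = - m (e, 0, 1) \<and>
      (\<forall>s. 0 \<le> s \<longrightarrow> s \<le> len e \<longrightarrow> f (pt e s) = f (pt e 0) + m (e, 0, 1) * s)" if e: "e \<in> arcs G" for e
  proof -
    have inner: "\<exists>a. (\<forall>\<^sub>F x in at_right 0. f (pt e (s + x)) = f (pt e s) + a * x) \<and>
        (\<forall>\<^sub>F x in at_right 0. f (pt e (s - x)) = f (pt e s) - a * x)" if s: "0 < s" "s < len e" for s
    proof -
      \<comment> \<open>At an interior point only two directions occur, so current balance makes
        their slopes opposite and excludes a kink.\<close>
      have "m (e, s, - 1) = - m (e, s, 1)"
        using sum0[of "Inner e s"] e s by (simp add: sum_directions_Inner)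
      then show ?thesis
        using slope[of "Inner e s" "(e, s, 1)"] slope[of "Inner e s" "(e, s, - 1)"] e s
        by (intro exI[of _ "m (e, s, 1)"]) (simp add: directions_Inner)
    qed
    have left: "\<forall>\<^sub>F x in at_right 0. f (pt e x) = f (pt e 0) + m (e, 0, 1) * x"
      using slope[of "Vertex (t e)" "(e, 0, 1)"] e by (simp add: directions_Vertex)
    have right: "\<forall>\<^sub>F x in at_right 0. f (pt e (len e - x)) = f (pt e (len e)) + m (e, len e, - 1) * x"
      using slope[of "Vertex (h e)" "(e, len e, - 1)"] e by (simp add: directions_Vertex)
    show ?thesis
      using locally_affine_imp_affine[of "len e" "\<lambda>s. f (pt e s)", OF len_pos[OF e] inner left right] by blast
  qed
  have slope_eq: "m (e, 0, 1) = (f (Vertex (h e)) - f (Vertex (t e))) / len e" if e: "e \<in> arcs G" for e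
    using edge[OF e] e by (auto dest!: spec[of _ "len e"] simp: less_imp_le)
  have "(\<Sum>q\<in>UNIV. lap $ p $ q * f (Vertex q)) = 0" for p
  proof -
    \<comment> \<open>The slopes at the ends of an edge are difference quotients of the vertex
      values, so the outgoing slopes at \<open>p\<close> add up to minus the Laplacian.\<close>
    have "(\<Sum>q\<in>UNIV. lap $ p $ q * f (Vertex q)) = - (\<Sum>d\<in>directions G len (Vertex p). m d)"
      unfolding laplacian_mult sum_directions_Vertex sum_negf[symmetric]
      by (intro sum.cong refl) (use edge in \<open>auto simp: slope_eq incidence_def diff_divide_distrib\<close>)
    then show ?thesis by (simp add: sum0)
  qed
  then have vertex: "f (Vertex p) = f (Vertex q)" for p q
    using laplacian_kernel[of "\<lambda>q. f (Vertex q)"] by blast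
  have "f x = f (Vertex p)" if "x \<in> \<Gamma>" for x p
  proof (cases x)
    case (Inner e s)
    then have *: "e \<in> arcs G" "0 < s" "s < len e" using that by auto
    then have "f (pt e s) = f (pt e 0) + m (e, 0, 1) * s"
      using edge[OF *(1)] by (blast intro: less_imp_le)
    then have "f (pt e s) = f (Vertex (t e))"
      using slope_eq[OF *(1)] vertex[of "h e" "t e"] by simp
    then show ?thesis using * vertex by (simp add: Inner)
  qed (simp add: vertex)
  then show ?thesis using xy by metis
qed

text \<open>The difference has no sources, so it is constant, and it vanishes at \<open>z\<close>;
  outside \<open>\<Gamma>\<close> both functions agree by extensionality.\<close>

lemma is_voltage_unique:
  assumes f: "is_voltage G len z y f" and g: "is_voltage G len z y g" and z: "z \<in> \<Gamma>"
  shows "f = g"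
proof -
  obtain m where m: "\<And>p d. p \<in> \<Gamma> \<Longrightarrow> d \<in> directions G len p \<Longrightarrow> has_slope G len f d (m d)"
    "\<And>p. p \<in> \<Gamma> \<Longrightarrow> (\<Sum>d\<in>directions G len p. - m d) = of_bool (p = y) - of_bool (p = z)"
    using f unfolding is_voltage_def by blast
  obtain n where n: "\<And>p d. p \<in> \<Gamma> \<Longrightarrow> d \<in> directions G len p \<Longrightarrow> has_slope G len g d (n d)"
    "\<And>p. p \<in> \<Gamma> \<Longrightarrow> (\<Sum>d\<in>directions G len p. - n d) = of_bool (p = y) - of_bool (p = z)"
    using g unfolding is_voltage_def by blast
  have "f x - g x = f z - g z" if "x \<in> \<Gamma>" for x
  proof (rule harmonic_constant[of "\<lambda>x. f x - g x" "\<lambda>d. m d - n d"])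
    show "(\<Sum>d\<in>directions G len p. m d - n d) = 0" if "p \<in> \<Gamma>" for p
      using m(2)[OF that] n(2)[OF that] by (simp add: sum_subtractf sum_negf)
  qed (use that z m(1) n(1) has_slope_diff in blast)+
  then have "f x = g x" if "x \<in> \<Gamma>" for x
    using f g that by (simp add: is_voltage_def)
  then show ?thesis
    using f g by (intro extensionalityI[of f \<Gamma> g]) (auto simp: is_voltage_def)
qed

lemma voltage_eq_green:
  assumes "x \<in> \<Gamma>" "y \<in> \<Gamma>" "z \<in> \<Gamma>"
  shows "voltage G len z x y = green x y - green x z - (green z y - green z z)"
proof -
  have "(THE f. is_voltage G len z y f) = restrict (\<lambda>x. green x y - green x z - (green z y - green z z)) \<Gamma>"
    using is_voltage_green[OF assms(2,3)] is_voltage_unique[OF _ _ assms(3)] by (intro the_equality)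
  then show ?thesis using assms by (simp add: voltage_def)
qed

lemma voltage_diag: "x \<in> \<Gamma> \<Longrightarrow> z \<in> \<Gamma> \<Longrightarrow> voltage G len z x x = resistance x z"
  by (simp add: voltage_eq_green resistance_def green_sym[of z x])

section \<open>The canonical measure\<close>

definition edge_weight :: "'e \<Rightarrow> real" where
  "edge_weight e = (len e - edge_resistance e) / (len e)\<^sup>2"

text \<open>The mass that gives \<open>hat _ p\<close> the integral
  \<open>1/v + (L k)_p / 2\<close>, where \<open>k\<close> is the diagonal of \<open>pinv\<close>:
  each edge already contributes half of its mass \<open>edge_weight e * len e\<close> at either end,
  and these halves are subtracted.\<close>

definition vertex_weight :: "'v \<Rightarrow> real" where
  "vertex_weight p = 1 / real CARD('v) + (\<Sum>q\<in>UNIV. lap $ p $ q * pinv $ q $ q) / 2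
     - (\<Sum>e\<in>arcs G. (of_bool (p = t e) + of_bool (p = h e)) * (edge_weight e * len e)) / 2"

text \<open>The left side is the integral against \<open>canonical\<close> of the function that
  interpolates \<open>f\<close> affinely along edges, since its mean over an edge is the average of
  the two end values.\<close>

lemma weighted_sum:
  "(\<Sum>p\<in>UNIV. vertex_weight p * f p) + (\<Sum>e\<in>arcs G. edge_weight e * (len e * (f (t e) + f (h e)) / 2)) =
   (\<Sum>p\<in>UNIV. f p) / real CARD('v) + (\<Sum>p\<in>UNIV. \<Sum>q\<in>UNIV. lap $ p $ q * f p * pinv $ q $ q) / 2"
proof -
  have "vertex_weight p * f p = f p / real CARD('v) + (\<Sum>q\<in>UNIV. lap $ p $ q * f p * pinv $ q $ q) / 2
      - (\<Sum>e\<in>arcs G. (of_bool (p = t e) + of_bool (p = h e)) * (edge_weight e * len e) * f p) / 2" for p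
    unfolding vertex_weight_def left_diff_distrib distrib_right
    by (simp add: sum_distrib_left sum_distrib_right algebra_simps)
  then have "(\<Sum>p\<in>UNIV. vertex_weight p * f p) =
      (\<Sum>p\<in>UNIV. f p) / real CARD('v) + (\<Sum>p\<in>UNIV. \<Sum>q\<in>UNIV. lap $ p $ q * f p * pinv $ q $ q) / 2
      - (\<Sum>p\<in>UNIV. \<Sum>e\<in>arcs G. (of_bool (p = t e) + of_bool (p = h e)) * (edge_weight e * len e) * f p) / 2"
    by (simp only: sum.distrib sum_subtractf sum_divide_distrib)
  also have "(\<Sum>p\<in>UNIV. \<Sum>e\<in>arcs G. (of_bool (p = t e) + of_bool (p = h e)) * (edge_weight e * len e) * f p) =
      (\<Sum>e\<in>arcs G. \<Sum>p\<in>UNIV. (edge_weight e * len e) * (of_bool (p = t e) * f p) + (edge_weight e * len e) * (of_bool (p = h e) * f p))"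
    by (subst sum.swap) (simp add: algebra_simps)
  also have "\<dots> = (\<Sum>e\<in>arcs G. edge_weight e * len e * (f (t e) + f (h e)))"
    unfolding sum.distrib sum_distrib_left[symmetric] by (simp add: distrib_left sum.distrib)
  finally show ?thesis
    by (simp add: sum_divide_distrib mult.assoc)
qed

text \<open>Point masses at vertices, obtained from the counting measure of a one-point space, and
  arc length along edges. As measures on one sigma algebra they can be combined by
  \<open>signed_integral_combination\<close>.\<close>

definition component :: "'v + 'e \<Rightarrow> ('v, 'e) mg_point measure" where
  "component = case_sum (\<lambda>p. distr (count_space {()}) M (\<lambda>_. Vertex p))
     (\<lambda>e. distr (restrict_space lborel {0..len e}) M (pt e))"

definition canonical :: "('v, 'e) mg_point set \<Rightarrow> real" where
  "canonical A = (\<Sum>i\<in>UNIV <+> arcs G. case_sum vertex_weight edge_weight i * measure (component i) A)"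

lemma sets_component [simp]: "sets (component i) = sets M"
  by (cases i) (simp_all add: component_def)

lemma finite_measure_component:
  assumes "i \<in> UNIV <+> arcs G"
  shows "finite_measure (component i)"
proof (cases i)
  case (Inl p)
  then show ?thesis
    by (auto simp: component_def intro!: finite_measure.finite_measure_distr finite_measure_count_space)
next
  case (Inr e)
  then have e: "e \<in> arcs G" using assms by auto
  have "finite_measure (restrict_space lborel {0..len e})"
    using e by (intro finite_measureI) (simp add: emeasure_restrict_space space_restrict_space less_imp_le)
  then show ?thesis
    using measurable_edge_point[OF e] by (simp add: component_def Inr finite_measure.finite_measure_distr)
qed

lemma integral_vertex_component:
  fixes f :: "('v, 'e) mg_point \<Rightarrow> real"
  assumes "f \<in> borel_measurable M"
  shows "(\<integral>x. f x \<partial>component (Inl p)) = f (Vertex p)"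
  unfolding component_def
  by (simp add: integral_distr assms lebesgue_integral_count_space_finite)

lemma integral_edge_component:
  fixes f :: "('v, 'e) mg_point \<Rightarrow> real"
  assumes e: "e \<in> arcs G" and f: "f \<in> borel_measurable M"
    and cont: "continuous_on {0..len e} (\<lambda>s. f (pt e s))"
    and I: "((\<lambda>s. f (pt e s)) has_integral I) {0..len e}"
  shows "(\<integral>x. f x \<partial>component (Inr e)) = I"
proof -
  have "(\<integral>x. f x \<partial>component (Inr e)) = (\<integral>s. f (pt e s) \<partial>restrict_space lborel {0..len e})"
    by (simp add: component_def integral_distr[OF measurable_edge_point[OF e] f])
  also have "\<dots> = (LINT s:{0..len e}|lborel. f (pt e s))"
    by (subst integral_restrict_space) (auto simp: set_lebesgue_integral_def)
  also have "\<dots> = integral {0..len e} (\<lambda>s. f (pt e s))"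
    by (intro set_borel_integral_eq_integral borel_integrable_atLeastAtMost' cont)
  also have "\<dots> = I" using I by (rule integral_unique)
  finally show ?thesis .
qed

lemma signed_measure_canonical: "signed_measure M canonical"
  unfolding canonical_def[abs_def]
  by (rule signed_measure_combination) (auto intro: finite_measure_component)

lemma signed_integral_canonical:
  assumes cont: "\<And>e. e \<in> arcs G \<Longrightarrow> continuous_on {0..len e} (\<lambda>s. f (pt e s))"
    and I: "\<And>e. e \<in> arcs G \<Longrightarrow> ((\<lambda>s. f (pt e s)) has_integral I e) {0..len e}"
  shows "signed_integral M canonical f =
    (\<Sum>p\<in>UNIV. vertex_weight p * f (Vertex p)) + (\<Sum>e\<in>arcs G. edge_weight e * I e)"
proof -
  have f: "f \<in> borel_measurable M" by (rule borel_measurable_edgewise[OF cont])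
  obtain B where B: "\<And>x. x \<in> \<Gamma> \<Longrightarrow> \<bar>f x\<bar> \<le> B" using bounded_edgewise[OF cont] by blast
  have "signed_integral M canonical f =
      (\<Sum>i\<in>UNIV <+> arcs G. case_sum vertex_weight edge_weight i * (\<integral>x. f x \<partial>component i))"
    unfolding canonical_def[abs_def]
    by (rule signed_integral_combination[where B = B])
       (auto intro: finite_measure_component f B)
  also have "\<dots> = (\<Sum>p\<in>UNIV. vertex_weight p * f (Vertex p)) + (\<Sum>e\<in>arcs G. edge_weight e * I e)"
    by (simp add: sum.Plus integral_vertex_component[OF f] integral_edge_component[OF _ f cont I] cong: sum.cong)
  finally show ?thesis .
qed

lemma canonical_total: "canonical \<Gamma> = 1"
proof -
  have "(\<integral>x. 1 \<partial>component i) = measure (component i) \<Gamma>" for i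
    using sets_eq_imp_space_eq[OF sets_component, of i] by simp
  then have "measure (component (Inl p)) \<Gamma> = 1" for p
    using integral_vertex_component[of "\<lambda>_. 1" p] by simp
  moreover have "measure (component (Inr e)) \<Gamma> = len e" if e: "e \<in> arcs G" for e
  proof -
    have "((\<lambda>s. 1 :: real) has_integral len e) {0..len e}"
      using has_integral_const_real[of "1::real" 0 "len e"] len_pos[OF e] by (simp add: less_imp_le)
    then show ?thesis
      using integral_edge_component[OF e, of "\<lambda>_. 1" "len e"] sets_eq_imp_space_eq[OF sets_component, of "Inr e"] by simp
  qed
  ultimately have "canonical \<Gamma> = (\<Sum>p\<in>UNIV. vertex_weight p * 1) + (\<Sum>e\<in>arcs G. edge_weight e * (len e * (1 + 1) / 2))"
    by (simp add: canonical_def sum.Plus cong: sum.cong)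
  \<comment> \<open>The constant function 1 has mean 1 over the vertices, and its Laplacian form
    vanishes.\<close>
  then show ?thesis
    using weighted_sum[of "\<lambda>_. 1"] laplacian_form[of "\<lambda>_. 1" "\<lambda>q. pinv $ q $ q"] by simp
qed

section \<open>Integrating the resistance against the canonical measure\<close>

lemma has_integral_bridge:
  assumes e: "e \<in> arcs G" and c: "0 \<le> c" "c \<le> len e"
  shows "((\<lambda>s. bridge e s c) has_integral c * (len e - c) / 2) {0..len e}"
proof -
  \<comment> \<open>The bridge is affine on either side of its kink at \<open>c\<close>, so the
    integral is split there.\<close>
  have "((\<lambda>s. s * (1 - c / len e)) has_integral (c\<^sup>2 / 2 * (1 - c / len e) - 0\<^sup>2 / 2 * (1 - c / len e))) {0..c}"
    by (rule fundamental_theorem_of_calculus)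
       (use c e in \<open>auto intro!: derivative_eq_intros simp flip: has_real_derivative_iff_has_vector_derivative\<close>)
  then have 1: "((\<lambda>s. bridge e s c) has_integral (c\<^sup>2 / 2 * (1 - c / len e) - 0\<^sup>2 / 2 * (1 - c / len e))) {0..c}"
    by (rule has_integral_eq[rotated]) (auto simp: bridge_def algebra_simps)
  have "((\<lambda>s. c - s * c / len e) has_integral
      ((c * len e - (len e)\<^sup>2 / 2 * c / len e) - (c * c - c\<^sup>2 / 2 * c / len e))) {c..len e}"
    by (rule fundamental_theorem_of_calculus)
       (use c e in \<open>auto intro!: derivative_eq_intros simp flip: has_real_derivative_iff_has_vector_derivative\<close>)
  then have 2: "((\<lambda>s. bridge e s c) has_integral
      ((c * len e - (len e)\<^sup>2 / 2 * c / len e) - (c * c - c\<^sup>2 / 2 * c / len e))) {c..len e}"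
    by (rule has_integral_eq[rotated]) (auto simp: bridge_def)
  have eq: "(c\<^sup>2 / 2 * (1 - c / len e) - 0\<^sup>2 / 2 * (1 - c / len e))
      + ((c * len e - (len e)\<^sup>2 / 2 * c / len e) - (c * c - c\<^sup>2 / 2 * c / len e)) = c * (len e - c) / 2"
    using e by (simp add: field_simps power2_eq_square)
  show ?thesis
    using has_integral_combine[OF c 1 2] unfolding eq .
qed

text \<open>Beyond affine interpolation there are two contributions: twice the integral of the
  bridge is \<open>pos e x * (len e - pos e x)\<close>, and \<open>u * (1 - u)\<close> with
  \<open>u = s / len e\<close> has mean 1/6 over the edge.\<close>

lemma has_integral_resistance:
  assumes e: "e \<in> arcs G" and x: "x \<in> \<Gamma>"
  shows "((\<lambda>s. resistance x (pt e s)) has_integral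
    len e * green x x - len e * (potential x (t e) + potential x (h e)) - pos e x * (len e - pos e x)
    + len e * (pinv $ t e $ t e + pinv $ h e $ h e) / 2 + len e * (len e - edge_resistance e) / 6) {0..len e}"
proof -
  define l where "l = len e"
  have l: "l > 0" using e by (simp add: l_def)
  define A B where "A = pinv $ t e $ t e - 2 * potential x (t e)" and "B = pinv $ h e $ h e - 2 * potential x (h e)"
  define C where "C = l - edge_resistance e"
  \<comment> \<open>With \<open>i\<close> for the inverse length the antiderivative \<open>F\<close>
    is a polynomial in \<open>s\<close>.\<close>
  define i where "i = 1 / l"
  define F where "F s = green x x * s + (s - s\<^sup>2 * i / 2) * A + (s\<^sup>2 * i / 2) * B + (s\<^sup>2 * i / 2 - s ^ 3 * i\<^sup>2 / 3) * C" for s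
  have "((\<lambda>s. green x x + (1 - s * i) * A + s * i * B + (s * i * (1 - s * i)) * C) has_integral F l - F 0) {0..l}"
  proof (rule fundamental_theorem_of_calculus)
    show "(F has_vector_derivative green x x + (1 - s * i) * A + s * i * B + (s * i * (1 - s * i)) * C) (at s within {0..l})"
      for s
      unfolding F_def has_real_derivative_iff_has_vector_derivative[symmetric]
      by (auto intro!: derivative_eq_intros simp: field_simps power2_eq_square)
  qed (use l in simp)
  moreover have "((\<lambda>s. bridge e s (pos e x)) has_integral pos e x * (l - pos e x) / 2) {0..l}"
    unfolding l_def using pos_nonneg[OF x] pos_less_len[OF e x] by (intro has_integral_bridge e) (auto simp: less_imp_le)
  ultimately have "((\<lambda>s. green x x + (1 - s * i) * A + s * i * B + (s * i * (1 - s * i)) * C - 2 * bridge e s (pos e x)) has_integral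
      (F l - F 0 - 2 * (pos e x * (l - pos e x) / 2))) {0..l}"
    by (intro has_integral_diff has_integral_mult_right)
  then have int: "((\<lambda>s. resistance x (pt e s)) has_integral (F l - F 0 - 2 * (pos e x * (l - pos e x) / 2))) {0..l}"
  proof (rule has_integral_eq[rotated])
    fix s assume s: "s \<in> {0..l}"
    have edge: "green (pt e s) x = (1 - s / l) * potential x (t e) + s / l * potential x (h e) + bridge e s (pos e x)"
      using s green_edge[OF e _ _ x] by (simp add: l_def)
    have diag: "green (pt e s) (pt e s) = (1 - s / l) * pinv $ t e $ t e + s / l * pinv $ h e $ h e + (s / l * (1 - s / l)) * C"
      using s green_diag_edge[OF e] by (simp add: l_def C_def)
    show "green x x + (1 - s * i) * A + s * i * B + (s * i * (1 - s * i)) * C - 2 * bridge e s (pos e x) = resistance x (pt e s)"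
      unfolding resistance_def green_sym[of x "pt e s"] edge diag A_def B_def i_def
      by (simp add: divide_inverse algebra_simps)
  qed
  have eq: "F l - F 0 - 2 * (pos e x * (l - pos e x) / 2) =
      l * green x x - l * (potential x (t e) + potential x (h e)) - pos e x * (l - pos e x)
      + l * (pinv $ t e $ t e + pinv $ h e $ h e) / 2 + l * (l - edge_resistance e) / 6"
    using l by (simp add: F_def A_def B_def C_def i_def field_simps power2_eq_square power3_eq_cube)
  show ?thesis using int unfolding eq unfolding l_def .
qed

text \<open>The first claimed formula in terms of lengths: the bracket squared in the theorem is
  \<open>- (len e - edge_resistance e)\<close>, as the Laplacian entry of an arc is
  \<open>- 1 / len e\<close>.\<close>

definition tau_value :: real where
  "tau_value = (\<Sum>e\<in>arcs G. (len e - edge_resistance e)\<^sup>2 / len e) / 12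
     + (\<Sum>p\<in>UNIV. \<Sum>q\<in>UNIV. lap $ p $ q * pinv $ p $ p * pinv $ q $ q) / 4 + trace pinv / real CARD('v)"

text \<open>The quadratic coefficient on \<open>e\<close> is exactly \<open>edge_weight e\<close>.
  This is the reason for that density: the bridges produce the same sum with opposite sign when
  \<open>resistance x\<close> is integrated.\<close>

lemma green_diag:
  assumes x: "x \<in> \<Gamma>"
  shows "green x x = (\<Sum>p\<in>UNIV. hat x p * pinv $ p $ p) + (\<Sum>e\<in>arcs G. edge_weight e * (pos e x * (len e - pos e x)))"
proof (cases x)
  case (Vertex v)
  then show ?thesis by (simp add: green_Vertex)
next
  case (Inner e s)
  then have s: "e \<in> arcs G" "0 < s" "s < len e" using x by auto
  have "(\<Sum>e'\<in>arcs G. edge_weight e' * (pos e' x * (len e' - pos e' x))) =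
      (\<Sum>e'\<in>arcs G. if e' = e then edge_weight e * (s * (len e - s)) else 0)"
    by (intro sum.cong) (auto simp: Inner)
  also have "\<dots> = (s / len e * (1 - s / len e)) * (len e - edge_resistance e)"
    using s by (simp add: edge_weight_def field_simps power2_eq_square)
  finally show ?thesis
    using green_diag_edge[of e s] sum_hat_edge[of e s "\<lambda>p. pinv $ p $ p"] s by (simp add: Inner)
qed

lemma sum_potential: "(\<Sum>p\<in>UNIV. potential x p) = 0"
proof -
  have "(\<Sum>p\<in>UNIV. potential x p) = (\<Sum>q\<in>UNIV. (\<Sum>p\<in>UNIV. pinv $ q $ p) * hat x q)"
    unfolding potential_def sum_distrib_right by (subst sum.swap) (simp add: pinv_sym)
  then show ?thesis by (simp add: pinv_row_sum)
qed

text \<open>By symmetry the Laplacian can be moved onto \<open>potential x\<close>, where it gives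
  \<open>hat x\<close> minus \<open>1/v\<close>.\<close>

lemma laplacian_form_potential:
  assumes x: "x \<in> \<Gamma>"
  shows "(\<Sum>p\<in>UNIV. \<Sum>q\<in>UNIV. lap $ p $ q * potential x p * f q) = (\<Sum>q\<in>UNIV. hat x q * f q) - (\<Sum>q\<in>UNIV. f q) / real CARD('v)"
proof -
  have "(\<Sum>p\<in>UNIV. \<Sum>q\<in>UNIV. lap $ p $ q * potential x p * f q) = (\<Sum>q\<in>UNIV. (\<Sum>p\<in>UNIV. lap $ q $ p * potential x p) * f q)"
    unfolding sum_distrib_right by (subst sum.swap) (simp add: laplacian_sym)
  then show ?thesis
    by (simp add: laplacian_mult_potential[OF x] left_diff_distrib sum_subtractf sum_divide_distrib)
qed

text \<open>\<open>weighted_sum\<close> integrates the affine interpolation of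
  \<open>resistance x\<close>. The total dependence on \<open>x\<close> is then
  \<open>green x x\<close> minus the interpolated diagonal of \<open>pinv\<close> minus the weighted
  quadratic terms, which is 0 by \<open>green_diag\<close>.\<close>

lemma signed_integral_canonical_resistance:
  assumes x: "x \<in> \<Gamma>"
  shows "signed_integral M canonical (resistance x) = 2 * tau_value"
proof -
  let ?k = "\<lambda>p. pinv $ p $ p"
  \<comment> \<open>\<open>H\<close> and \<open>S\<close> are the interpolated and the quadratic
    part of \<open>g = green x x\<close>; \<open>T\<close> is the trace divided by \<open>v\<close>,
    \<open>Q\<close> the Laplacian form of the diagonal of \<open>pinv\<close>, and \<open>Z\<close>
    the sum over the edges in \<open>tau_value\<close>.\<close>
  have arith: "I = 2 * (Z / 12 + Q / 4 + T)"
    if "I = g + T + (- 2 * (H - T) + Q) / 2 - S + Z / 6" "g = H + S" for I g T H Q S Z :: real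
    using that by (simp add: field_simps)
  \<comment> \<open>This is \<open>resistance x\<close> at the vertex \<open>p\<close>, the function
    to which \<open>weighted_sum\<close> is applied.\<close>
  define F where "F p = green x x - 2 * potential x p + ?k p" for p
  have "signed_integral M canonical (resistance x) = (\<Sum>p\<in>UNIV. vertex_weight p * resistance x (Vertex p))
      + (\<Sum>e\<in>arcs G. edge_weight e * (len e * green x x - len e * (potential x (t e) + potential x (h e)) - pos e x * (len e - pos e x)
    + len e * (?k (t e) + ?k (h e)) / 2 + len e * (len e - edge_resistance e) / 6))"
    by (intro signed_integral_canonical continuous_on_resistance has_integral_resistance x)
  also have "\<dots> = (\<Sum>p\<in>UNIV. vertex_weight p * F p)
      + (\<Sum>e\<in>arcs G. edge_weight e * (len e * (F (t e) + F (h e)) / 2)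
        - edge_weight e * (pos e x * (len e - pos e x)) + (len e - edge_resistance e)\<^sup>2 / len e / 6)"
  proof (intro arg_cong2[where f = "(+)"] sum.cong refl)
    fix p show "vertex_weight p * resistance x (Vertex p) = vertex_weight p * F p"
      using x by (simp add: resistance_def F_def green_Vertex green_sym[of x "Vertex p"])
  next
    fix e assume e: "e \<in> arcs G"
    define X where "X = (len e - edge_resistance e)\<^sup>2 / len e / 6"
    have X: "edge_weight e * (len e * (len e - edge_resistance e) / 6) = X"
      using e by (simp add: edge_weight_def X_def power2_eq_square)
    show "edge_weight e * (len e * green x x - len e * (potential x (t e) + potential x (h e)) - pos e x * (len e - pos e x)
        + len e * (?k (t e) + ?k (h e)) / 2 + len e * (len e - edge_resistance e) / 6) =
      edge_weight e * (len e * (F (t e) + F (h e)) / 2)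
        - edge_weight e * (pos e x * (len e - pos e x)) + (len e - edge_resistance e)\<^sup>2 / len e / 6"
      unfolding distrib_left[of "edge_weight e" _ "len e * (len e - edge_resistance e) / 6"] X X_def[symmetric]
      by (simp add: F_def field_simps)
  qed
  also have "\<dots> = ((\<Sum>p\<in>UNIV. F p) / real CARD('v) + (\<Sum>p\<in>UNIV. \<Sum>q\<in>UNIV. lap $ p $ q * F p * ?k q) / 2)
      - (\<Sum>e\<in>arcs G. edge_weight e * (pos e x * (len e - pos e x)))
      + (\<Sum>e\<in>arcs G. (len e - edge_resistance e)\<^sup>2 / len e) / 6"
    unfolding weighted_sum[of F, symmetric] by (simp add: sum.distrib sum_subtractf sum_divide_distrib)
  also have "(\<Sum>p\<in>UNIV. F p) / real CARD('v) = green x x + trace pinv / real CARD('v)"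
    by (simp add: F_def sum.distrib sum_subtractf sum_potential trace_def add_divide_distrib flip: sum_distrib_left)
  also have "(\<Sum>p\<in>UNIV. \<Sum>q\<in>UNIV. lap $ p $ q * F p * ?k q) =
      - 2 * ((\<Sum>q\<in>UNIV. hat x q * ?k q) - trace pinv / real CARD('v)) + (\<Sum>p\<in>UNIV. \<Sum>q\<in>UNIV. lap $ p $ q * ?k p * ?k q)"
  proof -
    have "(\<Sum>p\<in>UNIV. \<Sum>q\<in>UNIV. lap $ p $ q * F p * ?k q) = green x x * (\<Sum>p\<in>UNIV. \<Sum>q\<in>UNIV. lap $ p $ q * 1 * ?k q)
      - 2 * (\<Sum>p\<in>UNIV. \<Sum>q\<in>UNIV. lap $ p $ q * potential x p * ?k q) + (\<Sum>p\<in>UNIV. \<Sum>q\<in>UNIV. lap $ p $ q * ?k p * ?k q)"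
      by (simp add: F_def algebra_simps sum.distrib sum_subtractf sum_distrib_left)
    moreover have "(\<Sum>p\<in>UNIV. \<Sum>q\<in>UNIV. lap $ p $ q * 1 * ?k q) = 0"
      using laplacian_form[of "\<lambda>_. 1" ?k] by simp
    ultimately show ?thesis
      by (simp only: laplacian_form_potential[OF x] trace_def)
  qed
  finally show ?thesis
    unfolding tau_value_def by (rule arith) (rule green_diag[OF x])
qed

text \<open>\<open>canonical\<close> witnesses the value. Any other admissible measure also
  integrates the symmetric kernel \<open>resistance\<close> to a constant, and the exchange of
  integrals makes the two constants equal, so the definite description is justified.\<close>

lemma tau_eq: "tau G len = tau_value"
  unfolding tau_def
proof (rule the_equality)
  have volt: "signed_integral M \<nu> (\<lambda>\<zeta>. voltage G len \<zeta> x x) = signed_integral M \<nu> (resistance x)" if "x \<in> \<Gamma>" for \<nu> x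
    by (rule signed_integral_cong) (simp add: voltage_diag that)
  have "is_canonical_measure G len canonical"
    unfolding is_canonical_measure_def
    using signed_measure_canonical canonical_total signed_integral_canonical_resistance volt by auto
  then show "\<exists>\<nu>. is_canonical_measure G len \<nu> \<and>
     (\<forall>x\<in>\<Gamma>. tau_value = signed_integral M \<nu> (\<lambda>\<zeta>. voltage G len \<zeta> x x) / 2)"
    using volt signed_integral_canonical_resistance by (intro exI[of _ canonical]) auto
  fix u assume "\<exists>\<nu>. is_canonical_measure G len \<nu> \<and>
     (\<forall>x\<in>\<Gamma>. u = signed_integral M \<nu> (\<lambda>\<zeta>. voltage G len \<zeta> x x) / 2)"
  then obtain \<nu> where \<nu>: "signed_measure M \<nu>" "\<nu> (space M) = 1"
    "\<And>x. x \<in> space M \<Longrightarrow> signed_integral M \<nu> (resistance x) = 2 * u"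
    by (auto simp: is_canonical_measure_def volt)
  obtain B where B: "\<And>x y. x \<in> \<Gamma> \<Longrightarrow> y \<in> \<Gamma> \<Longrightarrow> \<bar>resistance x y\<bar> \<le> B"
    using resistance_bounded by blast
  have "2 * u = 2 * tau_value"
    by (rule signed_integral_symmetric_kernel_unique[OF measurable_resistance _ resistance_sym \<nu>(1,2) signed_measure_canonical _ \<nu>(3)])
       (auto intro: B signed_integral_canonical_resistance simp: canonical_total)
  then show "u = tau_value" by simp
qed

section \<open>Translation into entries of the Laplacian and its pseudo inverse\<close>

lemma laplacian_arc_square:
  assumes e: "e \<in> arcs G"
  shows "lap $ t e $ h e * (1 / (lap $ t e $ h e) + pinv $ t e $ t e - 2 * pinv $ t e $ h e + pinv $ h e $ h e)\<^sup>2 =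
    - ((len e - edge_resistance e)\<^sup>2 / len e)"
proof -
  have "(1 / (lap $ t e $ h e) + pinv $ t e $ t e - 2 * pinv $ t e $ h e + pinv $ h e $ h e) = - (len e - edge_resistance e)"
    by (simp add: laplacian_arc[OF e] edge_resistance_def)
  then show ?thesis by (simp only: power2_minus) (simp add: laplacian_arc[OF e])
qed

text \<open>The Dirichlet form turns the double sum into squared differences along arcs, with
  \<open>1 / len e\<close> being minus the Laplacian entry; this converts the first formula into the
  second.\<close>

lemma laplacian_form_pinv_diag:
  "(\<Sum>p\<in>UNIV. \<Sum>q\<in>UNIV. lap $ p $ q * pinv $ p $ p * pinv $ q $ q) =
    - (\<Sum>e\<in>arcs G. lap $ t e $ h e * (pinv $ t e $ t e - pinv $ h e $ h e)\<^sup>2)"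
  unfolding laplacian_form sum_negf[symmetric]
  by (intro sum.cong refl) (simp add: laplacian_arc power2_eq_square algebra_simps diff_divide_distrib add_divide_distrib)

end

theorem theorem4p10:
  fixes G :: "('v::finite, 'e) pre_digraph" and len :: "'e \<Rightarrow> real"
    and L Lp :: "real ^ 'v ^ 'v"
  assumes "metrized_graph G len"
    and "optimal_vertex_set G"
    and "verts G = UNIV"
    and "L = discrete_laplacian G len"
    and "Lp = pseudo_inverse L"
  shows
    "tau G len =
       - (1 / 12) * (\<Sum>e\<in>arcs G. let p = tail G e; q = head G e in
           L $ p $ q * (1 / (L $ p $ q) + Lp $ p $ p - 2 * Lp $ p $ q + Lp $ q $ q)\<^sup>2)
       + (1 / 4) * (\<Sum>q\<in>verts G. \<Sum>s\<in>verts G. L $ q $ s * Lp $ q $ q * Lp $ s $ s)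
       + (1 / real (card (verts G))) * trace Lp
     \<and>
     tau G len =
       - (1 / 12) * (\<Sum>e\<in>arcs G. let p = tail G e; q = head G e in
           L $ p $ q * (1 / (L $ p $ q) + Lp $ p $ p - 2 * Lp $ p $ q + Lp $ q $ q)\<^sup>2)
       - (1 / 4) * (\<Sum>e\<in>arcs G. let p = tail G e; q = head G e in
           L $ p $ q * (Lp $ p $ p - Lp $ q $ q)\<^sup>2)
       + (1 / real (card (verts G))) * trace Lp"
proof -
  interpret optimal_metrized_graph G len
    using assms(1-3) by unfold_locales
  have "(\<Sum>e\<in>arcs G. let p = tail G e; q = head G e in
      L $ p $ q * (1 / (L $ p $ q) + Lp $ p $ p - 2 * Lp $ p $ q + Lp $ q $ q)\<^sup>2) =
      - (\<Sum>e\<in>arcs G. (len e - edge_resistance e)\<^sup>2 / len e)"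
    unfolding Let_def assms(4,5) sum_negf[symmetric] by (intro sum.cong refl laplacian_arc_square)
  then have first: "tau G len =
       - (1 / 12) * (\<Sum>e\<in>arcs G. let p = tail G e; q = head G e in
           L $ p $ q * (1 / (L $ p $ q) + Lp $ p $ p - 2 * Lp $ p $ q + Lp $ q $ q)\<^sup>2)
       + (1 / 4) * (\<Sum>q\<in>verts G. \<Sum>s\<in>verts G. L $ q $ s * Lp $ q $ q * Lp $ s $ s)
       + (1 / real (card (verts G))) * trace Lp"
    by (simp add: tau_eq tau_value_def assms(3-5))
  have second: "(\<Sum>q\<in>verts G. \<Sum>s\<in>verts G. L $ q $ s * Lp $ q $ q * Lp $ s $ s) =
      - (\<Sum>e\<in>arcs G. let p = tail G e; q = head G e in L $ p $ q * (Lp $ p $ p - Lp $ q $ q)\<^sup>2)"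
    unfolding Let_def assms(3-5) by (rule laplacian_form_pinv_diag)
  show ?thesis
    by (rule conjI[OF first]) (use first[unfolded second] in \<open>simp only: mult_minus_right add_uminus_conv_diff\<close>)
qed

end
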